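(* Let $m\ge1$, $P_1,\dots,P_m>0$ and $a_{ij}\in\mathbb{R}$ for $i,j=1,\dots,m$. Consider the continuous-time white Gaussian interference channel without feedback, with $m$ pairs of senders and receivers: for $i=1,\dots,m$, $$Y_i(t)=\sum_{j=1}^ma_{ij}\int_0^tX_j(s,M_j)\,ds+B_i(t),\qquad t\ge0,$$ where $B_1,\dots,B_m$ are (possibly correlated) standard Brownian motions, with power constraints $P_1,\dots,P_m$. The capacity region of this channel is $$\{(R_1,R_2,\dots,R_m)\in\mathbb{R}_+^m:\ R_i\le a_{ii}^2P_i/2,\ i=1,2,\dots,m\}.$$
   Context: $X_j$ is the channel input from sender $j$, depending only on $M_j$, the message of sender $j$. The messages are independent of each other and of the Brownian motions; $M_j$ is uniformly distributed on its message alphabet. $Y_{i,0}^T=\{Y_i(r):0\le r\le T\}$. For $T,R_1,\dots,R_m,P_1,\dots,P_m>0$, a $(T,(e^{TR_1},\dots,e^{TR_m}),(P_1,\dots,P_m))$-code consists of message alphabets $\mathcal{M}_i=\{1,2,\dots,e^{TR_i}\}$ ($e^{TR_i}$ being understood as its integer part), encoding functions $X_i:\mathcal{M}_i\to C[0,T]$ such that for each $i$, with probability 1, $\frac1T\int_0^TX_i^2(s,M_i)\,ds\le P_i$, and decoding functions $g_i:C[0,T]\to\mathcal{M}_i$, $i=1,\dots,m$. Its average probability of error is $$P_e^{(T)}=\frac{1}{e^{T\sum_iR_i}}\sum_{(M_1,\dots,M_m)\in\mathcal{M}_1\times\cdots\times\mathcal{M}_m}P\{g_i(Y_{i,0}^T)\ne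 M_i\text{ for some }i\mid(M_1,\dots,M_m)\text{ sent}\}.$$ A rate tuple $(R_1,\dots,R_m)$ is achievable if there exists a sequence of such codes with $P_e^{(T)}\to0$ as $T\to\infty$. The capacity region is the closure of the set of all achievable rate tuples.
   Formalization: Codes are allowed rates R_i ≥ 0 rather than only R_i > 0, because if some a_ii = 0 no tuple of strictly positive rates is achievable and the capacity region would be empty; when all a_ii ≠ 0 the region is the same. *)

theory Defs
  imports "HOL-Probability.Probability"
begin

(* This concerns a single process: several Brownian motions on the same space may depend on each
   other in any way.  Continuity is required of every path rather than of almost every path, so
   that a channel output is always an element of C[0,T]. *)
definition standard_brownian_motion :: "'a measure \<Rightarrow> (real \<Rightarrow> 'a \<Rightarrow> real) \<Rightarrow> bool" where
  "standard_brownian_motion M B \<longleftrightarrow>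
     prob_space M \<and>
     (\<forall>t\<ge>0. B t \<in> borel_measurable M) \<and>
     (AE \<omega> in M. B 0 \<omega> = 0) \<and>
     (\<forall>(n::nat) (t::nat \<Rightarrow> real). 0 \<le> t 0 \<and> (\<forall>k<n. t k \<le> t (Suc k)) \<longrightarrow>
        prob_space.indep_vars M (\<lambda>_. borel) (\<lambda>k \<omega>. B (t (Suc k)) \<omega> - B (t k) \<omega>) {..<n}) \<and>
     (\<forall>s t. 0 \<le> s \<and> s < t \<longrightarrow>
        distributed M lborel (\<lambda>\<omega>. B t \<omega> - B s \<omega>) (normal_density 0 (sqrt (t - s)))) \<and>
     (\<forall>\<omega>\<in>space M. continuous_on {0..} (\<lambda>t. B t \<omega>))"

(* C[0,T]: an element is represented by its extension to the real line that is constantly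
   undefined outside [0,T]. *)
definition C_interval :: "real \<Rightarrow> (real \<Rightarrow> real) set" where
  "C_interval T = {x \<in> extensional {0..T}. continuous_on {0..T} x}"

(* C[0,T] with the sigma-algebra generated by the evaluations, which is also the Borel
   sigma-algebra of the supremum norm. *)
definition C_measurable_space :: "real \<Rightarrow> (real \<Rightarrow> real) measure" where
  "C_measurable_space T = restrict_space (\<Pi>\<^sub>M t\<in>{0..T}. (borel :: real measure)) (C_interval T)"

definition messages :: "real \<Rightarrow> real \<Rightarrow> nat set" where
  "messages T r = {1..nat \<lfloor>exp (T * r)\<rfloor>}"

definition message_tuples :: "real \<Rightarrow> real^'m \<Rightarrow> ('m::finite \<Rightarrow> nat) set" where
  "message_tuples T R = (\<Pi>\<^sub>E i\<in>UNIV. messages T (R $ i))"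

(* the joint law of independent messages, each uniform on its alphabet *)
definition message_law :: "real \<Rightarrow> real^'m \<Rightarrow> ('m::finite \<Rightarrow> nat) measure" where
  "message_law T R = (\<Pi>\<^sub>M i\<in>UNIV. uniform_count_measure (messages T (R $ i)))"

(* Zero rates, for which the alphabet is a singleton, are admitted: a receiver with a $ i $ i = 0
   supports no positive rate, so with positive rates only there would be no achievable tuple. *)
definition is_code ::
  "real \<Rightarrow> real^'m \<Rightarrow> real^'m \<Rightarrow> ('m::finite \<Rightarrow> nat \<Rightarrow> real \<Rightarrow> real) \<Rightarrow>
   ('m \<Rightarrow> (real \<Rightarrow> real) \<Rightarrow> nat) \<Rightarrow> bool" where
  "is_code T R P X g \<longleftrightarrow>
     T > 0 \<and> (\<forall>i. R $ i \<ge> 0) \<and> (\<forall>i. P $ i > 0) \<and>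
     (\<forall>i. X i \<in> messages T (R $ i) \<rightarrow> C_interval T) \<and>
     (\<forall>i. AE w in message_law T R. 1 / T * integral {0..T} (\<lambda>s. (X i (w i) s)\<^sup>2) \<le> P $ i) \<and>
     (\<forall>i. g i \<in> C_measurable_space T \<rightarrow>\<^sub>M count_space (messages T (R $ i)))"

definition channel_output ::
  "real^'m^'m \<Rightarrow> ('m \<Rightarrow> real \<Rightarrow> 'a \<Rightarrow> real) \<Rightarrow> ('m \<Rightarrow> nat \<Rightarrow> real \<Rightarrow> real) \<Rightarrow>
   'm::finite \<Rightarrow> real \<Rightarrow> ('m \<Rightarrow> nat) \<times> 'a \<Rightarrow> real" where
  "channel_output a B X i t = (\<lambda>(w, \<omega>).
     (\<Sum>j\<in>UNIV. a $ i $ j * integral {0..t} (\<lambda>s. X j (w j) s)) + B i t \<omega>)"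

definition output_path ::
  "real^'m^'m \<Rightarrow> ('m \<Rightarrow> real \<Rightarrow> 'a \<Rightarrow> real) \<Rightarrow> ('m \<Rightarrow> nat \<Rightarrow> real \<Rightarrow> real) \<Rightarrow>
   real \<Rightarrow> 'm::finite \<Rightarrow> ('m \<Rightarrow> nat) \<times> 'a \<Rightarrow> real \<Rightarrow> real" where
  "output_path a B X T i z = (\<lambda>t\<in>{0..T}. channel_output a B X i t z)"

(* The messages are independent of the noise, whence the product measure.  The normalising factor
   exp (T * (\<Sum>i. R $ i)) is, with the integer part convention, the number of message tuples. *)
definition error_probability ::
  "'a measure \<Rightarrow> ('m \<Rightarrow> real \<Rightarrow> 'a \<Rightarrow> real) \<Rightarrow> real^'m^'m \<Rightarrow> real \<Rightarrow> real^'m \<Rightarrow>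
   ('m::finite \<Rightarrow> nat \<Rightarrow> real \<Rightarrow> real) \<Rightarrow> ('m \<Rightarrow> (real \<Rightarrow> real) \<Rightarrow> nat) \<Rightarrow> real" where
  "error_probability M B a T R X g =
     1 / (\<Prod>i\<in>UNIV. real (card (messages T (R $ i)))) *
     (\<Sum>w\<in>message_tuples T R.
        \<P>(z in message_law T R \<Otimes>\<^sub>M M.
          (\<exists>i. g i (output_path a B X T i z) \<noteq> fst z i) \<bar> fst z = w))"

definition achievable ::
  "'a measure \<Rightarrow> ('m \<Rightarrow> real \<Rightarrow> 'a \<Rightarrow> real) \<Rightarrow> real^'m^'m \<Rightarrow> real^'m \<Rightarrow> real^'m::finite \<Rightarrow> bool" where
  "achievable M B a P R \<longleftrightarrow>
     (\<exists>T X g. filterlim T at_top sequentially \<and>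
        (\<forall>n::nat. is_code (T n) R P (X n) (g n)) \<and>
        (\<lambda>n. error_probability M B a (T n) R (X n) (g n)) \<longlonglongrightarrow> 0)"

definition capacity_region ::
  "'a measure \<Rightarrow> ('m \<Rightarrow> real \<Rightarrow> 'a \<Rightarrow> real) \<Rightarrow> real^'m^'m \<Rightarrow> real^'m \<Rightarrow> (real^'m::finite) set" where
  "capacity_region M B a P = closure {R. achievable M B a P R}"

end

(* Converse: a code word of receiver i shifts the channel output by a path of energy at most
   E = a_ii^2 P_i T.  For finitely many increments the likelihood ratio against the output without
   this code word is explicit, and Cauchy-Schwarz bounds its energy by E, so
   Q(A) <= exp(kappa) P(A) + epsilon for cylinder sets A, and by approximation for all measurable A.
   Averaging over the messages of receiver i bounds their number by about exp(kappa), where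
   kappa = T (a_ii^2 P_i / 2 + delta) still makes epsilon vanish as T grows.

   Achievability: the bandwidth is unlimited, so interference can be avoided altogether.  Every
   message of every sender sends a single pulse of full energy in a time slot of its own.  Receiver
   i compares the increments of its output over the slots of sender i with a threshold; a Gaussian
   tail estimate and the union bound give vanishing error whenever R_i < a_ii^2 P_i / 2.  No joint
   law of the Brownian motions is used. *)
theory Submission
  imports Defs
begin

section \<open>Change of measure for Gaussian vectors\<close>

text \<open>The converse works on finite time grids, where the output increments are independent and
  normal, and must survive the passage to arbitrary measurable decoders. The likelihood ratio is
  unbounded, so a purely multiplicative bound fails; the additive term pays for the part above
  \<open>exp \<kappa>\<close>. Its size depends on the grid only through a sum that the energy
  bounds, so one inequality holds on every grid and no density on path space is needed. With all
  messages fixed, interference is a deterministic drift common to the two outputs compared, and each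
  receiver can be treated alone.

  In the code, a pulse carries the whole energy P_i T in a slot of length d. In units of sqrt d, the
  standard deviation of the noise increment, its signal is nearly |a_ii| sqrt(P_i T) for every d, so
  slots may be as short as the number of messages demands. A threshold at sqrt(2 \<rho> T) with R_i
  < \<rho> < a_ii^2 P_i / 2 has false alarm probability at most exp(- \<rho> T) per slot, which
  beats the at most exp(R_i T) slots of sender i, while the true pulse clears it by a multiple of
  sqrt T.\<close>

lemma normal_density_tilt:
  assumes "\<sigma> > 0"
  shows "exp (\<theta> * ((x * h - h\<^sup>2 / 2) / \<sigma>\<^sup>2)) * normal_density 0 \<sigma> x =
         exp (\<theta> * (\<theta> - 1) / 2 * (h\<^sup>2 / \<sigma>\<^sup>2)) * normal_density (\<theta> * h) \<sigma> x"
proof -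
  \<comment> \<open>Completing the square: a tilt of order \<theta> moves the mean to
    \<open>\<theta> * h\<close> and leaves a constant factor, which is 1 for order 1.\<close>
  have "\<theta> * ((x * h - h\<^sup>2 / 2) / \<sigma>\<^sup>2) - (x - 0)\<^sup>2 / (2 * \<sigma>\<^sup>2) =
        \<theta> * (\<theta> - 1) / 2 * (h\<^sup>2 / \<sigma>\<^sup>2) - (x - \<theta> * h)\<^sup>2 / (2 * \<sigma>\<^sup>2)"
    using assms by (simp add: field_simps power2_eq_square)
  then have "exp (\<theta> * ((x * h - h\<^sup>2 / 2) / \<sigma>\<^sup>2)) * exp (- (x - 0)\<^sup>2 / (2 * \<sigma>\<^sup>2)) =
      exp (\<theta> * (\<theta> - 1) / 2 * (h\<^sup>2 / \<sigma>\<^sup>2)) * exp (- (x - \<theta> * h)\<^sup>2 / (2 * \<sigma>\<^sup>2))"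
    unfolding exp_add[symmetric] by simp
  from arg_cong[OF this, of "(*) (1 / sqrt (2 * pi * \<sigma>\<^sup>2))"] show ?thesis
    unfolding normal_density_def by (simp only: ac_simps)
qed

lemma nn_integral_normal_density:
  "\<sigma> > 0 \<Longrightarrow> (\<integral>\<^sup>+x. ennreal (normal_density \<mu> \<sigma> x) \<partial>lborel) = 1"
  using prob_space.emeasure_space_1[OF prob_space_normal_density[of \<sigma> \<mu>]]
  by (simp add: emeasure_density)

text \<open>The exponent without \<theta> is the log-likelihood ratio of the normal laws with means
  \<open>h\<close> and 0, so this is a moment of order \<theta> of the ratio. After the tilt the
  integrand is a constant times a normal density of mass 1.\<close>

lemma nn_integral_likelihood_power:
  assumes "\<sigma> > 0"
  shows "(\<integral>\<^sup>+x. ennreal (exp (\<theta> * ((x * h - h\<^sup>2 / 2) / \<sigma>\<^sup>2))) \<partial>density lborel (normal_density 0 \<sigma>)) =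
         ennreal (exp (\<theta> * (\<theta> - 1) / 2 * (h\<^sup>2 / \<sigma>\<^sup>2)))"
proof -
  have "(\<integral>\<^sup>+x. ennreal (exp (\<theta> * ((x * h - h\<^sup>2 / 2) / \<sigma>\<^sup>2))) \<partial>density lborel (normal_density 0 \<sigma>)) =
        (\<integral>\<^sup>+x. ennreal (exp (\<theta> * ((x * h - h\<^sup>2 / 2) / \<sigma>\<^sup>2)) * normal_density 0 \<sigma> x) \<partial>lborel)"
    by (subst nn_integral_density) (auto simp: mult.commute simp flip: ennreal_mult')
  also have "\<dots> = (\<integral>\<^sup>+x. ennreal (exp (\<theta> * (\<theta> - 1) / 2 * (h\<^sup>2 / \<sigma>\<^sup>2))) * ennreal (normal_density (\<theta> * h) \<sigma> x) \<partial>lborel)"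
    unfolding normal_density_tilt[OF assms] by (simp add: ennreal_mult')
  also have "\<dots> = ennreal (exp (\<theta> * (\<theta> - 1) / 2 * (h\<^sup>2 / \<sigma>\<^sup>2)))"
    using assms by (simp add: nn_integral_cmult nn_integral_normal_density)
  finally show ?thesis .
qed

lemma density_normal_likelihood:
  assumes "\<sigma> > 0"
  shows "density (density lborel (normal_density 0 \<sigma>)) (\<lambda>x. ennreal (exp ((x * h - h\<^sup>2 / 2) / \<sigma>\<^sup>2))) =
         density lborel (normal_density h \<sigma>)"
proof -
  have "exp ((x * h - h\<^sup>2 / 2) / \<sigma>\<^sup>2) * normal_density 0 \<sigma> x = normal_density h \<sigma> x" for x
    using normal_density_tilt[OF assms, of 1 x h] by simp
  then show ?thesis
    by (subst density_density_eq) (auto simp: ennreal_mult'[symmetric] mult.commute)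
qed

text \<open>A product measure is determined by its values on boxes, and over a box both the
  likelihood ratio and the indicator factor over the coordinates, so the integral splits.\<close>

lemma PiM_normal_shift_density:
  fixes h \<sigma> :: "'i \<Rightarrow> real"
  assumes I: "finite I" and \<sigma>: "\<And>i. \<sigma> i > 0"
  shows "(\<Pi>\<^sub>M i\<in>I. density lborel (normal_density (h i) (\<sigma> i))) =
         density (\<Pi>\<^sub>M i\<in>I. density lborel (normal_density 0 (\<sigma> i)))
           (\<lambda>x. \<Prod>i\<in>I. ennreal (exp ((x i * h i - (h i)\<^sup>2 / 2) / (\<sigma> i)\<^sup>2)))"
    (is "?Q = density ?P ?L")
proof -
  interpret P: product_prob_space "\<lambda>i. density lborel (normal_density 0 (\<sigma> i))" I
    by (rule product_prob_spaceI) (rule prob_space_normal_density[OF \<sigma>])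
  interpret Q: product_prob_space "\<lambda>i. density lborel (normal_density (h i) (\<sigma> i))" I
    by (rule product_prob_spaceI) (rule prob_space_normal_density[OF \<sigma>])
  show ?thesis
  proof (rule Q.PiM_eqI[OF I, symmetric])
    have "sets ?P = sets ?Q" by (rule sets_PiM_cong) auto
    then show "sets (density ?P ?L) = sets ?Q" by simp
  next
    fix A assume A: "\<And>i. i \<in> I \<Longrightarrow> A i \<in> sets (density lborel (normal_density (h i) (\<sigma> i)))"
    then have A': "A i \<in> sets borel" if "i \<in> I" for i using that by simp
    let ?l = "\<lambda>i x. ennreal (exp ((x * h i - (h i)\<^sup>2 / 2) / (\<sigma> i)\<^sup>2))"
    have S: "Pi\<^sub>E I A \<in> sets ?P" using I A' by (intro sets_PiM_I_finite) auto
    have "emeasure (density ?P ?L) (Pi\<^sub>E I A) = (\<integral>\<^sup>+x. ?L x * indicator (Pi\<^sub>E I A) x \<partial>?P)"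
      using S by (subst emeasure_density) auto
    also have "\<dots> = (\<integral>\<^sup>+x. (\<Prod>i\<in>I. ?l i (x i) * indicator (A i) (x i)) \<partial>?P)"
    proof (rule nn_integral_cong)
      fix x assume "x \<in> space ?P"
      then have "indicator (Pi\<^sub>E I A) x = (\<Prod>i\<in>I. indicator (A i) (x i) :: ennreal)"
        using I by (cases "x \<in> Pi\<^sub>E I A") (auto simp: space_PiM PiE_iff indicator_def intro!: prod_zero[symmetric] prod.neutral[symmetric])
      then show "?L x * indicator (Pi\<^sub>E I A) x = (\<Prod>i\<in>I. ?l i (x i) * indicator (A i) (x i))"
        by (simp add: prod.distrib)
    qed
    also have "\<dots> = (\<Prod>i\<in>I. \<integral>\<^sup>+x. ?l i x * indicator (A i) x \<partial>density lborel (normal_density 0 (\<sigma> i)))"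
      using A' I by (intro P.product_nn_integral_prod) auto
    also have "\<dots> = (\<Prod>i\<in>I. emeasure (density lborel (normal_density (h i) (\<sigma> i))) (A i))"
      using A' by (intro prod.cong refl)
        (subst density_normal_likelihood[OF \<sigma>, symmetric], subst emeasure_density, auto)
    finally show "emeasure (density ?P ?L) (Pi\<^sub>E I A) =
        (\<Prod>i\<in>I. emeasure (density lborel (normal_density (h i) (\<sigma> i))) (A i))" .
  qed
qed

text \<open>Truncation at \<kappa>: below it the first term suffices, above it \<open>exp u\<close>
  may be multiplied by \<open>exp (s * (u - \<kappa>))\<close>, which is at least 1.\<close>

lemma le_threshold_plus_power:
  fixes u :: real
  assumes "s > 0"
  shows "exp u \<le> exp \<kappa> + exp (- s * \<kappa>) * exp ((1 + s) * u)"
proof (cases "u \<le> \<kappa>")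
  case False
  then have "s * \<kappa> \<le> s * u" using assms by simp
  then have "u \<le> - s * \<kappa> + (1 + s) * u" by (simp add: algebra_simps)
  then have "exp u \<le> exp (- s * \<kappa>) * exp ((1 + s) * u)"
    by (simp flip: exp_add)
  then show ?thesis by (simp add: add_increasing)
qed (simp add: add_increasing2)

text \<open>The likelihood ratio L of the two measures satisfies L \<le> c + L^(1+s) / c^s with
  c = exp \<kappa>; integrating this over S gives the bound. A small s makes the last term
  exponentially small as soon as \<kappa> exceeds half the energy.\<close>

lemma PiM_normal_shift_bound:
  fixes h \<sigma> :: "'i \<Rightarrow> real"
  assumes I: "finite I" and \<sigma>: "\<And>i. \<sigma> i > 0" and s: "s > 0"
    and S: "S \<in> sets (\<Pi>\<^sub>M i\<in>I. borel)"
  shows "emeasure (\<Pi>\<^sub>M i\<in>I. density lborel (normal_density (h i) (\<sigma> i))) S \<le>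
         ennreal (exp \<kappa>) * emeasure (\<Pi>\<^sub>M i\<in>I. density lborel (normal_density 0 (\<sigma> i))) S +
         ennreal (exp (- s * \<kappa> + s * (1 + s) / 2 * (\<Sum>i\<in>I. (h i)\<^sup>2 / (\<sigma> i)\<^sup>2)))"
    (is "emeasure ?Q S \<le> _ * emeasure ?P S + _")
proof -
  interpret P: product_prob_space "\<lambda>i. density lborel (normal_density 0 (\<sigma> i))" I
    by (rule product_prob_spaceI) (rule prob_space_normal_density[OF \<sigma>])
  let ?u = "\<lambda>i x. (x * h i - (h i)\<^sup>2 / 2) / (\<sigma> i)\<^sup>2"
  let ?L = "\<lambda>x. \<Prod>i\<in>I. ennreal (exp (?u i (x i)))"
  have "sets ?P = sets (\<Pi>\<^sub>M i\<in>I. (borel::real measure))" by (rule sets_PiM_cong) auto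
  with S have S': "S \<in> sets ?P" by simp
  have L: "?L x \<le> ennreal (exp \<kappa>) + ennreal (exp (- s * \<kappa>)) * (\<Prod>i\<in>I. ennreal (exp ((1 + s) * ?u i (x i))))" for x
  proof -
    have "?L x = ennreal (exp (\<Sum>i\<in>I. ?u i (x i)))"
      using I by (simp add: prod_ennreal exp_sum)
    also have "\<dots> \<le> ennreal (exp \<kappa> + exp (- s * \<kappa>) * exp ((1 + s) * (\<Sum>i\<in>I. ?u i (x i))))"
      by (intro ennreal_leI le_threshold_plus_power s)
    also have "\<dots> = ennreal (exp \<kappa>) + ennreal (exp (- s * \<kappa>)) * (\<Prod>i\<in>I. ennreal (exp ((1 + s) * ?u i (x i))))"
      using I by (simp add: prod_ennreal exp_sum sum_distrib_left ennreal_mult' prod_nonneg del: times_divide_eq_right)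
    finally show ?thesis .
  qed
  have "emeasure ?Q S = (\<integral>\<^sup>+x. ?L x * indicator S x \<partial>?P)"
    unfolding PiM_normal_shift_density[OF I \<sigma>, of h] using S' by (subst emeasure_density) auto
  also have "\<dots> \<le> (\<integral>\<^sup>+x. ennreal (exp \<kappa>) * indicator S x +
      ennreal (exp (- s * \<kappa>)) * (\<Prod>i\<in>I. ennreal (exp ((1 + s) * ?u i (x i)))) \<partial>?P)"
    using L by (intro nn_integral_mono) (auto simp: indicator_def)
  also have "\<dots> = ennreal (exp \<kappa>) * emeasure ?P S + ennreal (exp (- s * \<kappa>)) *
      (\<integral>\<^sup>+x. (\<Prod>i\<in>I. ennreal (exp ((1 + s) * ?u i (x i)))) \<partial>?P)"
    using S' by (simp add: nn_integral_add nn_integral_cmult)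
  \<comment> \<open>Independence turns the moment of order \<open>1 + s\<close> into a product;
    \<open>\<theta> * (\<theta> - 1) / 2\<close> at \<open>\<theta> = 1 + s\<close> is the origin of
    \<open>s * (1 + s) / 2\<close>.\<close>
  also have "(\<integral>\<^sup>+x. (\<Prod>i\<in>I. ennreal (exp ((1 + s) * ?u i (x i)))) \<partial>?P) =
      (\<Prod>i\<in>I. ennreal (exp ((1 + s) * ((1 + s) - 1) / 2 * ((h i)\<^sup>2 / (\<sigma> i)\<^sup>2))))"
    using I by (subst P.product_nn_integral_prod) (auto simp: nn_integral_likelihood_power[OF \<sigma>, simplified] intro!: prod.cong)
  also have "\<dots> = ennreal (exp (s * (1 + s) / 2 * (\<Sum>i\<in>I. (h i)\<^sup>2 / (\<sigma> i)\<^sup>2)))"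
    using I by (simp add: prod_ennreal exp_sum sum_distrib_left mult.commute)
  also have "ennreal (exp (- s * \<kappa>)) * \<dots> =
      ennreal (exp (- s * \<kappa> + s * (1 + s) / 2 * (\<Sum>i\<in>I. (h i)\<^sup>2 / (\<sigma> i)\<^sup>2)))"
    unfolding exp_add by (simp add: ennreal_mult')
  finally show ?thesis .
qed

section \<open>Shifted Brownian paths\<close>

text \<open>A deterministic drift only translates the independent increments, so it changes the
  means and nothing else. The times must increase strictly: an increment over an empty interval has
  no density.\<close>

lemma brownian_increments_distr:
  assumes bm: "standard_brownian_motion M B" and n: "n > 0" and t0: "0 \<le> t 0"
    and t: "\<And>k. k < n \<Longrightarrow> t k < t (Suc k)"
  shows "distr M (\<Pi>\<^sub>M k\<in>{..<n}. borel) (\<lambda>\<omega>. \<lambda>k\<in>{..<n}. B (t (Suc k)) \<omega> - B (t k) \<omega> + h k) =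
         (\<Pi>\<^sub>M k\<in>{..<n}. density lborel (normal_density (h k) (sqrt (t (Suc k) - t k))))"
proof -
  interpret prob_space M using bm by (simp add: standard_brownian_motion_def)
  have pos: "0 \<le> t k" if "k \<le> n" for k
    using that by (induction k) (use t0 t in \<open>auto intro: order_trans less_imp_le simp: Suc_le_eq\<close>)
  have [measurable]: "B s \<in> borel_measurable M" if "s \<ge> 0" for s
    using bm that by (simp add: standard_brownian_motion_def)
  have "indep_vars (\<lambda>_. borel) (\<lambda>k \<omega>. B (t (Suc k)) \<omega> - B (t k) \<omega>) {..<n}"
    using bm t0 t by (simp add: standard_brownian_motion_def less_imp_le)
  then have ind: "indep_vars (\<lambda>_. borel) (\<lambda>k \<omega>. B (t (Suc k)) \<omega> - B (t k) \<omega> + h k) {..<n}"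
    by (rule indep_vars_compose2[where Y = "\<lambda>k x. x + h k"]) simp
  have "distr M (\<Pi>\<^sub>M k\<in>{..<n}. borel) (\<lambda>\<omega>. \<lambda>k\<in>{..<n}. B (t (Suc k)) \<omega> - B (t k) \<omega> + h k) =
        (\<Pi>\<^sub>M k\<in>{..<n}. distr M borel (\<lambda>\<omega>. B (t (Suc k)) \<omega> - B (t k) \<omega> + h k))"
    using n pos ind by (subst indep_vars_iff_distr_eq_PiM'[symmetric]) auto
  also have "\<dots> = (\<Pi>\<^sub>M k\<in>{..<n}. density lborel (normal_density (h k) (sqrt (t (Suc k) - t k))))"
  proof (rule PiM_cong)
    fix k assume "k \<in> {..<n}"
    then have k: "k < n" by simp
    have "distributed M lborel (\<lambda>\<omega>. B (t (Suc k)) \<omega> - B (t k) \<omega>)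
        (normal_density 0 (sqrt (t (Suc k) - t k)))"
      using bm pos[of k] t[OF k] k by (simp add: standard_brownian_motion_def)
    then have "distributed M lborel (\<lambda>\<omega>. h k + 1 * (B (t (Suc k)) \<omega> - B (t k) \<omega>))
        (normal_density (h k + 1 * 0) (\<bar>1\<bar> * sqrt (t (Suc k) - t k)))"
      by (rule normal_density_affine) (use t[OF k] in auto)
    then have "distributed M lborel (\<lambda>\<omega>. B (t (Suc k)) \<omega> - B (t k) \<omega> + h k)
        (normal_density (h k) (sqrt (t (Suc k) - t k)))"
      by (simp add: add.commute)
    moreover have "distr M borel (\<lambda>\<omega>. B (t (Suc k)) \<omega> - B (t k) \<omega> + h k) =
        distr M lborel (\<lambda>\<omega>. B (t (Suc k)) \<omega> - B (t k) \<omega> + h k)"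
      by (rule distr_cong) simp_all
    ultimately show "distr M borel (\<lambda>\<omega>. B (t (Suc k)) \<omega> - B (t k) \<omega> + h k) =
        density lborel (normal_density (h k) (sqrt (t (Suc k) - t k)))"
      by (simp add: distributed_distr_eq_density)
  qed simp
  finally show ?thesis .
qed

text \<open>Cauchy-Schwarz against the constant 1, obtained from the nonnegativity of the integral
  of \<open>(y s - m)\<^sup>2\<close> with \<open>m\<close> the mean of \<open>y\<close>. Summed
  over a grid, it bounds the energy of the increments independently of the grid.\<close>

lemma square_integral_le:
  fixes y :: "real \<Rightarrow> real"
  assumes uv: "u < v" and y: "continuous_on {u..v} y"
  shows "(integral {u..v} y)\<^sup>2 / (v - u) \<le> integral {u..v} (\<lambda>s. (y s)\<^sup>2)"
proof -
  define m where "m = integral {u..v} y / (v - u)"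
  have [intro, simp]: "y integrable_on {u..v}" "(\<lambda>s. (y s)\<^sup>2) integrable_on {u..v}"
    using y by (auto intro!: integrable_continuous_real continuous_intros)
  have "((\<lambda>s. (y s)\<^sup>2) has_integral integral {u..v} (\<lambda>s. (y s)\<^sup>2)) {u..v}"
    and "((\<lambda>s. 2 * m * y s) has_integral 2 * m * integral {u..v} y) {u..v}"
    and "((\<lambda>s. m\<^sup>2) has_integral m\<^sup>2 * (v - u)) {u..v}"
    using uv has_integral_const_real[of "m\<^sup>2" u v]
    by (simp_all add: integrable_integral has_integral_mult_right mult.commute[of "v - u"])
  then have lin: "((\<lambda>s. (y s)\<^sup>2 - 2 * m * y s + m\<^sup>2) has_integral
      integral {u..v} (\<lambda>s. (y s)\<^sup>2) - 2 * m * integral {u..v} y + m\<^sup>2 * (v - u)) {u..v}"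
    by (intro has_integral_add has_integral_diff)
  have "0 \<le> integral {u..v} (\<lambda>s. (y s - m)\<^sup>2)"
    by (rule integral_nonneg) (use y in \<open>auto intro!: integrable_continuous_real continuous_intros\<close>)
  also have "\<dots> = integral {u..v} (\<lambda>s. (y s)\<^sup>2 - 2 * m * y s + m\<^sup>2)"
    by (simp add: power2_diff algebra_simps)
  also have "\<dots> = integral {u..v} (\<lambda>s. (y s)\<^sup>2) - 2 * m * integral {u..v} y + m\<^sup>2 * (v - u)"
    by (rule integral_unique) (rule lin)
  also have "\<dots> = integral {u..v} (\<lambda>s. (y s)\<^sup>2) - (integral {u..v} y)\<^sup>2 / (v - u)"
  proof -
    have "m\<^sup>2 * (v - u) = m * integral {u..v} y" "(integral {u..v} y)\<^sup>2 / (v - u) = m * integral {u..v} y"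
      using uv by (simp_all add: m_def power2_eq_square)
    then show ?thesis by simp
  qed
  finally show ?thesis by simp
qed

section \<open>Partitions of the time interval\<close>

lemma sum_integral_partition:
  fixes f :: "real \<Rightarrow> real"
  assumes "\<And>k. k < n \<Longrightarrow> t k \<le> t (Suc k)" and "f integrable_on {t 0..t n}"
  shows "(\<Sum>k<n. integral {t k..t (Suc k)} f) = integral {t 0..t n} f"
  using assms
proof (induction n)
  case (Suc n)
  have le: "t 0 \<le> t k" if "k \<le> n" for k
    using that
  proof (induction k)
    case (Suc k)
    then show ?case using Suc.prems Suc.IH \<open>\<And>k. k < Suc n \<Longrightarrow> t k \<le> t (Suc k)\<close>[of k] by simp
  qed simp
  have "f integrable_on {t 0..t n}"
    by (rule integrable_on_subinterval[OF Suc.prems(2)]) (use Suc.prems(1)[of n] in auto)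
  with Suc have "(\<Sum>k<n. integral {t k..t (Suc k)} f) = integral {t 0..t n} f" by simp
  with Henstock_Kurzweil_Integration.integral_combine[where a = "t 0" and c = "t n" and b = "t (Suc n)" and f = f] Suc.prems le[of n] show ?case
    by simp
qed simp

lemma ex_enumeration_of_finite_set:
  fixes T :: real
  assumes K: "finite K" "0 \<in> K" "T \<in> K" "K \<subseteq> {0..T}" and T: "0 < T"
  shows "\<exists>t n. n > (0::nat) \<and> (\<forall>k<n. t k < t (Suc k)) \<and> t ` {..n} = K \<and> t 0 = 0 \<and> t n = T"
proof -
  define L where "L = sorted_list_of_set K"
  have set: "set L = K" and srt: "sorted_wrt (<) L"
    using K(1) by (simp_all add: L_def)
  have ne: "L \<noteq> []" using set K by auto
  let ?t = "\<lambda>k. L ! k" and ?n = "length L - 1"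
  have mono: "?t j < ?t k" if "j < k" "k < length L" for j k
    using srt that by (rule sorted_wrt_nth_less)
  have "?t ` {..<length L} = set L" by (auto simp: set_conv_nth)
  moreover have "{..<length L} = {..?n}" using ne by (cases L) auto
  ultimately have im: "?t ` {..?n} = K" using set by simp
  from K(2) im obtain j where j: "j \<le> ?n" "?t j = 0" by (metis atMost_iff imageE)
  from K(3) im obtain l where l: "l \<le> ?n" "?t l = T" by (metis atMost_iff imageE)
  have mem: "?t k \<in> {0..T}" if "k \<le> ?n" for k using that im K(4) by blast
  have lt: "k < length L" if "k \<le> ?n" for k using that ne by (cases L) auto
  have "j = 0" using mono[of 0 j] mem[of 0] j lt by (cases "j = 0") auto
  moreover have "l = ?n" using mono[of l ?n] mem[of ?n] l lt by (cases "l = ?n") auto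
  moreover have "0 < ?n" using j l T calculation by (cases "?n = 0") auto
  moreover have "\<forall>k<?n. ?t k < ?t (Suc k)" using mono by auto
  ultimately show ?thesis using im j l by blast
qed

text \<open>The values of the path at the times in \<open>J\<close> are partial sums of increments
  over a grid through \<open>J\<close>, so the event is one about independent normal variables whose
  means are the integrals of \<open>y\<close> over the cells. The drift \<open>f0\<close> is
  arbitrary; it will be the interference.\<close>

lemma cylinder_shift_bound:
  assumes bm: "standard_brownian_motion M B" and T: "0 < T"
    and y: "continuous_on {0..T} y" and E: "integral {0..T} (\<lambda>s. (y s)\<^sup>2) \<le> E"
    and f: "\<And>t. t \<in> {0..T} \<Longrightarrow> f1 t = f0 t + integral {0..t} y"
    and J: "finite J" "J \<subseteq> {0..T}" and S: "S \<in> sets (\<Pi>\<^sub>M t\<in>J. borel)" and s: "s > 0"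
  shows "measure M {\<omega>\<in>space M. (\<lambda>t\<in>J. f1 t + B t \<omega>) \<in> S} \<le>
     exp \<kappa> * measure M {\<omega>\<in>space M. (\<lambda>t\<in>J. f0 t + B t \<omega>) \<in> S} + exp (- s * \<kappa> + s * (1 + s) / 2 * E)"
proof -
  interpret prob_space M using bm by (simp add: standard_brownian_motion_def)
  have Bm[measurable]: "B s \<in> borel_measurable M" if "s \<ge> 0" for s
    using bm that by (simp add: standard_brownian_motion_def)
  obtain t and n :: nat where n: "n > 0" and t: "\<And>k. k < n \<Longrightarrow> t k < t (Suc k)"
    and im: "t ` {..n} = J \<union> {0, T}" and t0: "t 0 = 0" and tn: "t n = T"
    using ex_enumeration_of_finite_set[of "J \<union> {0, T}" T] J T by auto
  have mono: "t j \<le> t k \<longleftrightarrow> j \<le> k" if "j \<le> n" "k \<le> n" for j k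
  proof -
    have less: "t j < t k" if "j < k" "k \<le> n" for j k
      using that
    proof (induction k)
      case (Suc k)
      then show ?case using t[of k] by (cases "j = k") auto
    qed simp
    show ?thesis using less[of j k] less[of k j] that by (cases j k rule: linorder_cases) auto
  qed
  have tmem: "t k \<in> {0..T}" if "k \<le> n" for k
  proof -
    have "t k \<in> J \<union> {0, T}" unfolding im[symmetric] using that by simp
    then show ?thesis using J T by auto
  qed
  have tle: "t k \<le> t (Suc k)" if "k < n" for k using t[OF that] by simp
  define h where "h k = integral {t k..t (Suc k)} y" for k
  \<comment> \<open>The value 1 from \<open>n\<close> on is a dummy that keeps \<sigma> positive at
    every index, as the Gaussian bound requires.\<close>
  define \<sigma> where "\<sigma> k = (if k < n then sqrt (t (Suc k) - t k) else 1)" for k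
  have \<sigma>: "\<sigma> k > 0" for k using t by (simp add: \<sigma>_def)
  define D where "D g \<omega> = (\<lambda>k\<in>{..<n}. B (t (Suc k)) \<omega> - B (t k) \<omega> + g k)" for g :: "nat \<Rightarrow> real" and \<omega>
  let ?N = "\<Pi>\<^sub>M k\<in>{..<n}. (borel :: real measure)"
  \<comment> \<open>Rebuilds the sampled path from its increments: at time \<open>r\<close> all
    cells that end by \<open>r\<close> contribute.\<close>
  define \<Gamma> where "\<Gamma> d = (\<lambda>r\<in>J. f0 r + (\<Sum>k\<in>{k. k < n \<and> t (Suc k) \<le> r}. d k))" for d
  have yi: "y integrable_on {u..v}" if "0 \<le> u" "v \<le> T" for u v
    by (intro integrable_continuous_real continuous_on_subset[OF y]) (use that in auto)
  have y2i: "(\<lambda>s. (y s)\<^sup>2) integrable_on {u..v}" if "0 \<le> u" "v \<le> T" for u v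
    by (intro integrable_continuous_real continuous_intros continuous_on_subset[OF y]) (use that in auto)
  have D_meas[measurable]: "D g \<in> measurable M ?N" for g
    unfolding D_def using tmem by (intro measurable_restrict) auto
  have \<Gamma>_meas[measurable]: "\<Gamma> \<in> measurable ?N (\<Pi>\<^sub>M t\<in>J. borel)"
    unfolding \<Gamma>_def by (intro measurable_restrict borel_measurable_add borel_measurable_sum
      borel_measurable_const measurable_component_singleton) auto
  define S' where "S' = \<Gamma> -` S \<inter> space ?N"
  have S': "S' \<in> sets ?N" unfolding S'_def using \<Gamma>_meas S by (rule measurable_sets)
  have distr: "distr M ?N (D g) = (\<Pi>\<^sub>M k\<in>{..<n}. density lborel (normal_density (g k) (\<sigma> k)))" for g
    unfolding D_def using brownian_increments_distr[where t = t and h = g, OF bm n _ t] t0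
    by (auto simp: \<sigma>_def intro!: PiM_cong)
  \<comment> \<open>\<open>G\<close> is the accumulated drift on the grid and \<open>g\<close> its
    increments. The instance with the integral of \<open>y\<close> gives the shifted output, the
    zero instance the reference output, and both use the same set \<open>S'\<close>.\<close>
  have key: "measure M {\<omega>\<in>space M. (\<lambda>r\<in>J. f0 r + G r + B r \<omega>) \<in> S} =
      measure (\<Pi>\<^sub>M k\<in>{..<n}. density lborel (normal_density (g k) (\<sigma> k))) S'"
    if G: "\<And>m. m \<le> n \<Longrightarrow> G (t m) = (\<Sum>k<m. g k)" for G g
  proof -
    have mG: "{\<omega>\<in>space M. (\<lambda>r\<in>J. f0 r + G r + B r \<omega>) \<in> S} \<in> sets M"
    proof -
      have "(\<lambda>\<omega>. \<lambda>r\<in>J. f0 r + G r + B r \<omega>) \<in> measurable M (\<Pi>\<^sub>M t\<in>J. borel)"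
        using J by (intro measurable_restrict) auto
      from measurable_sets[OF this S] show ?thesis by (rule back_subst[of "\<lambda>A. A \<in> sets M"]) auto
    qed
    \<comment> \<open>The telescoping sum leaves \<open>- B 0\<close>, which vanishes only almost
      surely, so the events are compared up to a null set.\<close>
    have "AE \<omega> in M. B 0 \<omega> = 0" using bm by (simp add: standard_brownian_motion_def)
    then have "AE \<omega> in M. \<omega> \<in> {\<omega>\<in>space M. (\<lambda>r\<in>J. f0 r + G r + B r \<omega>) \<in> S} \<longleftrightarrow>
        \<omega> \<in> D g -` S' \<inter> space M"
    proof eventually_elim
      case (elim \<omega>)
      have "\<Gamma> (D g \<omega>) = (\<lambda>r\<in>J. f0 r + G r + B r \<omega>)"
        unfolding \<Gamma>_def
      proof (rule restrict_ext)
        fix r assume "r \<in> J"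
        then have "r \<in> t ` {..n}" using im by blast
        then obtain m where m: "m \<le> n" "r = t m" by auto
        have "{k. k < n \<and> t (Suc k) \<le> r} = {..<m}"
          using m mono by (auto simp: Suc_le_eq)
        then have "(\<Sum>k\<in>{k. k < n \<and> t (Suc k) \<le> r}. D g \<omega> k) =
            (\<Sum>k<m. (B (t (Suc k)) \<omega> - B (t k) \<omega>) + g k)"
          using m by (auto simp: D_def intro!: sum.cong)
        also have "\<dots> = B (t m) \<omega> - B (t 0) \<omega> + G (t m)"
          using sum_lessThan_telescope[of "\<lambda>k. B (t k) \<omega>" m] by (simp only: sum.distrib G[OF m(1)])
        finally show "f0 r + (\<Sum>k\<in>{k. k < n \<and> t (Suc k) \<le> r}. D g \<omega> k) = f0 r + G r + B r \<omega>"
          using m elim t0 by simp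
      qed
      moreover have "D g \<omega> \<in> space ?N" by (auto simp: D_def space_PiM)
      ultimately show ?case by (auto simp: S'_def)
    qed
    then have "measure M {\<omega>\<in>space M. (\<lambda>r\<in>J. f0 r + G r + B r \<omega>) \<in> S} = measure M (D g -` S' \<inter> space M)"
      using mG S' by (intro finite_measure_eq_AE) auto
    also have "\<dots> = measure (distr M ?N (D g)) S'"
      using S' by (subst measure_distr) auto
    finally show ?thesis unfolding distr .
  qed
  have F: "integral {0..t m} y = (\<Sum>k<m. h k)" if "m \<le> n" for m
  proof -
    have "(\<Sum>k<m. integral {t k..t (Suc k)} y) = integral {t 0..t m} y"
      by (rule sum_integral_partition) (use that tle tmem[OF that] t0 in \<open>auto intro!: yi\<close>)
    then show ?thesis by (simp add: h_def t0)
  qed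
  have "measure M {\<omega>\<in>space M. (\<lambda>t\<in>J. f1 t + B t \<omega>) \<in> S} =
      measure M {\<omega>\<in>space M. (\<lambda>r\<in>J. f0 r + integral {0..r} y + B r \<omega>) \<in> S}"
  proof -
    have "(\<lambda>t\<in>J. f1 t + B t \<omega>) = (\<lambda>r\<in>J. f0 r + integral {0..r} y + B r \<omega>)" for \<omega>
      using f J by (intro restrict_ext) auto
    then show ?thesis by simp
  qed
  also have "\<dots> = measure (\<Pi>\<^sub>M k\<in>{..<n}. density lborel (normal_density (h k) (\<sigma> k))) S'"
    by (rule key) (rule F)
  finally have 1: "measure M {\<omega>\<in>space M. (\<lambda>t\<in>J. f1 t + B t \<omega>) \<in> S} =
      measure (\<Pi>\<^sub>M k\<in>{..<n}. density lborel (normal_density (h k) (\<sigma> k))) S'" .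
  have 0: "measure M {\<omega>\<in>space M. (\<lambda>t\<in>J. f0 t + B t \<omega>) \<in> S} =
      measure (\<Pi>\<^sub>M k\<in>{..<n}. density lborel (normal_density 0 (\<sigma> k))) S'"
    using key[of "\<lambda>_. 0" "\<lambda>_. 0"] by simp
  have prob: "prob_space (\<Pi>\<^sub>M k\<in>{..<n}. density lborel (normal_density (g k) (\<sigma> k)))" for g
    unfolding distr[symmetric] by (rule prob_space_distr) measurable
  \<comment> \<open>Cauchy-Schwarz on each cell, with the cell length equal to the variance of the
    increment.\<close>
  have e: "(\<Sum>k<n. (h k)\<^sup>2 / (\<sigma> k)\<^sup>2) \<le> E"
  proof -
    have "(\<Sum>k<n. (h k)\<^sup>2 / (\<sigma> k)\<^sup>2) \<le> (\<Sum>k<n. integral {t k..t (Suc k)} (\<lambda>s. (y s)\<^sup>2))"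
    proof (rule sum_mono)
      fix k assume "k \<in> {..<n}"
      then have k: "k < n" by simp
      then have "continuous_on {t k..t (Suc k)} y"
        using tmem[of k] tmem[of "Suc k"] by (intro continuous_on_subset[OF y]) auto
      from square_integral_le[OF t[OF k] this]
      show "(h k)\<^sup>2 / (\<sigma> k)\<^sup>2 \<le> integral {t k..t (Suc k)} (\<lambda>s. (y s)\<^sup>2)"
        using k t[OF k] by (simp add: h_def \<sigma>_def)
    qed
    also have "\<dots> = integral {0..T} (\<lambda>s. (y s)\<^sup>2)"
      using sum_integral_partition[of n t "\<lambda>s. (y s)\<^sup>2", OF tle] y2i[of 0 T] by (simp add: t0 tn)
    finally show ?thesis using E by simp
  qed
  interpret P: prob_space "\<Pi>\<^sub>M k\<in>{..<n}. density lborel (normal_density 0 (\<sigma> k))" by (rule prob)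
  interpret Q: prob_space "\<Pi>\<^sub>M k\<in>{..<n}. density lborel (normal_density (h k) (\<sigma> k))" by (rule prob)
  have "emeasure (\<Pi>\<^sub>M k\<in>{..<n}. density lborel (normal_density (h k) (\<sigma> k))) S' \<le>
      ennreal (exp \<kappa>) * emeasure (\<Pi>\<^sub>M k\<in>{..<n}. density lborel (normal_density 0 (\<sigma> k))) S' +
      ennreal (exp (- s * \<kappa> + s * (1 + s) / 2 * (\<Sum>k<n. (h k)\<^sup>2 / (\<sigma> k)\<^sup>2)))"
    by (rule PiM_normal_shift_bound) (use \<sigma> s S' in auto)
  then have "measure (\<Pi>\<^sub>M k\<in>{..<n}. density lborel (normal_density (h k) (\<sigma> k))) S' \<le>
      exp \<kappa> * measure (\<Pi>\<^sub>M k\<in>{..<n}. density lborel (normal_density 0 (\<sigma> k))) S' +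
      exp (- s * \<kappa> + s * (1 + s) / 2 * (\<Sum>k<n. (h k)\<^sup>2 / (\<sigma> k)\<^sup>2))"
    unfolding Q.emeasure_eq_measure P.emeasure_eq_measure
    by (subst (asm) ennreal_mult'[symmetric], simp, subst (asm) ennreal_plus[symmetric], simp, simp,
        subst (asm) ennreal_le_iff) auto
  also have "\<dots> \<le> exp \<kappa> * measure (\<Pi>\<^sub>M k\<in>{..<n}. density lborel (normal_density 0 (\<sigma> k))) S' +
      exp (- s * \<kappa> + s * (1 + s) / 2 * E)"
  proof -
    have "s * (1 + s) / 2 * (\<Sum>k<n. (h k)\<^sup>2 / (\<sigma> k)\<^sup>2) \<le> s * (1 + s) / 2 * E"
      using s by (intro mult_left_mono[OF e]) auto
    then show ?thesis by (intro add_left_mono) (simp only: exp_le_cancel_iff add_le_cancel_left)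
  qed
  finally show ?thesis unfolding 0 1 .
qed

text \<open>The sets that can be approximated from the algebra form a sigma-algebra. Two measures
  are handled at once because a single cylinder set has to be close to \<open>A\<close> under both
  output laws.\<close>

lemma symmetric_difference_approximation:
  assumes N1: "finite_measure N1" "sets N1 = sigma_sets \<Omega> G"
    and N2: "finite_measure N2" "sets N2 = sigma_sets \<Omega> G"
    and G: "algebra \<Omega> G" and A: "A \<in> sigma_sets \<Omega> G" and e: "(e::real) > 0"
  shows "\<exists>C\<in>G. measure N1 (A - C \<union> (C - A)) < e \<and> measure N2 (A - C \<union> (C - A)) < e"
  using A e
proof (induction arbitrary: e rule: sigma_sets.induct)
  case (Basic a)
  then show ?case by (intro bexI[of _ a]) auto
next
  case Empty
  then show ?case using algebra.axioms(1)[OF G] by (intro bexI[of _ "{}"]) (auto simp: ring_of_sets_def semiring_of_sets_def semiring_of_sets_axioms_def)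
next
  case (Compl a)
  interpret algebra \<Omega> G by fact
  from Compl.IH[OF Compl.prems] obtain C where C: "C \<in> G"
    "measure N1 (a - C \<union> (C - a)) < e" "measure N2 (a - C \<union> (C - a)) < e" by auto
  have "a \<subseteq> \<Omega>" using Compl.hyps sigma_sets_into_sp[OF space_closed] by auto
  moreover have "C \<subseteq> \<Omega>" using C space_closed by auto
  ultimately have "\<Omega> - a - (\<Omega> - C) \<union> (\<Omega> - C - (\<Omega> - a)) = a - C \<union> (C - a)" by auto
  with C show ?case by (intro bexI[of _ "\<Omega> - C"]) auto
next
  case (Union a)
  interpret algebra \<Omega> G by fact
  define U where "U = (\<Union>i. a i)"
  \<comment> \<open>What the first \<open>n\<close> sets miss of the union. It decreases to the
    empty set, so some \<open>n\<close> makes it small for both measures; only then are the first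
    \<open>n\<close> sets approximated, with a tolerance depending on \<open>n\<close>.\<close>
  define V where "V n = U - (\<Union>i<n. a i)" for n :: nat
  have a: "a i \<in> sigma_sets \<Omega> G" for i by fact
  have V: "V n \<in> sigma_sets \<Omega> G" for n
  proof -
    have "U - (\<Union>i<n. a i) \<in> sets N1"
      unfolding U_def using a by (intro sets.Diff sets.countable_UN sets.finite_UN) (auto simp: N1(2))
    then show ?thesis by (simp add: V_def N1(2))
  qed
  have small: "eventually (\<lambda>n. measure N (V n) < e / 2) sequentially"
    if N: "finite_measure N" "sets N = sigma_sets \<Omega> G" for N
  proof -
    have "(\<lambda>n. measure N (V n)) \<longlonglongrightarrow> measure N (\<Inter>n. V n)"
      by (rule finite_measure.finite_Lim_measure_decseq[OF N(1)])
        (use V N in \<open>auto simp: decseq_def V_def\<close>)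
    moreover have "(\<Inter>n. V n) = {}" by (auto simp: V_def U_def)
    ultimately have "(\<lambda>n. measure N (V n)) \<longlonglongrightarrow> 0" by simp
    then show ?thesis using Union.prems by (intro order_tendstoD(2)[where y = 0]) auto
  qed
  obtain n where n: "measure N1 (V n) < e / 2" "measure N2 (V n) < e / 2"
    using eventually_happens[OF eventually_conj[OF small[OF N1] small[OF N2]]] by auto
  \<comment> \<open>\<open>n\<close> errors of this size sum to at most \<open>e / 2\<close>; the
    \<open>+ 1\<close> keeps the tolerance positive when \<open>n\<close> is 0.\<close>
  let ?d = "e / (2 * (real n + 1))"
  have d: "?d > 0" using Union.prems by simp
  from Union.IH[OF d] obtain C where C: "\<And>i. C i \<in> G"
    "\<And>i. measure N1 (a i - C i \<union> (C i - a i)) < ?d" "\<And>i. measure N2 (a i - C i \<union> (C i - a i)) < ?d"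
    by metis
  define D where "D = (\<Union>i<n. C i)"
  have D: "D \<in> G" unfolding D_def using C by (intro finite_UN) auto
  have bound: "measure N (U - D \<union> (D - U)) < e"
    if N: "finite_measure N" "sets N = sigma_sets \<Omega> G" and Vn: "measure N (V n) < e / 2"
      and d: "\<And>i. measure N (a i - C i \<union> (C i - a i)) < ?d" for N
  proof -
    interpret N: finite_measure N by fact
    define W where "W i = a i - C i \<union> (C i - a i)" for i
    have W: "W i \<in> sets N" for i
    proof -
      have "a i \<in> sets N" "C i \<in> sets N" using a[of i] C(1)[of i] by (auto simp: N(2))
      then show ?thesis unfolding W_def by (intro sets.Un sets.Diff)
    qed
    then have UW: "(\<Union>i<n. W i) \<in> sets N" by auto
    have VN: "V n \<in> sets N" using V N by simp
    have "measure N (U - D \<union> (D - U)) \<le> measure N (V n \<union> (\<Union>i<n. W i))"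
      using UW VN by (intro N.finite_measure_mono sets.Un) (auto simp: V_def D_def U_def W_def)
    also have "\<dots> \<le> measure N (V n) + measure N (\<Union>i<n. W i)"
      using UW VN by (intro measure_Un_le)
    also have "measure N (\<Union>i<n. W i) \<le> (\<Sum>i<n. measure N (W i))"
      using W by (intro N.finite_measure_subadditive_finite) auto
    also have "\<dots> \<le> (\<Sum>i<n. ?d)"
      using d by (intro sum_mono less_imp_le) (auto simp: W_def)
    also have "\<dots> \<le> e / 2"
      using Union.prems by (simp add: field_simps)
    finally show ?thesis using Vn by simp
  qed
  show ?case
    using bound[OF N1 n(1) C(2)] bound[OF N2 n(2) C(3)] D unfolding U_def by blast
qed

text \<open>The constants of the cylinder bound do not involve the cylinder, so the inequality
  passes to every set that cylinders approximate under both laws, hence to the generated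
  sigma-algebra.\<close>

lemma path_shift_bound:
  assumes bm: "standard_brownian_motion M B" and T: "0 < T"
    and y: "continuous_on {0..T} y" and E: "integral {0..T} (\<lambda>s. (y s)\<^sup>2) \<le> E"
    and f: "\<And>t. t \<in> {0..T} \<Longrightarrow> f1 t = f0 t + integral {0..t} y"
    and A: "A \<in> sets (\<Pi>\<^sub>M t\<in>{0..T}. borel)" and s: "s > 0"
  shows "measure M {\<omega>\<in>space M. (\<lambda>t\<in>{0..T}. f1 t + B t \<omega>) \<in> A} \<le>
     exp \<kappa> * measure M {\<omega>\<in>space M. (\<lambda>t\<in>{0..T}. f0 t + B t \<omega>) \<in> A} + exp (- s * \<kappa> + s * (1 + s) / 2 * E)"
proof -
  interpret prob_space M using bm by (simp add: standard_brownian_motion_def)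
  have Bm: "B s \<in> borel_measurable M" if "s \<ge> 0" for s
    using bm that by (simp add: standard_brownian_motion_def)
  let ?I = "{0..T}"
  let ?N = "\<Pi>\<^sub>M t\<in>?I. (borel :: real measure)"
  \<comment> \<open>This interpretation only supplies the algebra of cylinder sets; the measures are irrelevant.\<close>
  interpret R: product_prob_space "\<lambda>_. return borel (0::real)" ?I
    by (rule product_prob_spaceI) (rule prob_space_return, simp)
  have cong: "sets (Pi\<^sub>M J (\<lambda>_. return borel (0::real))) = sets (\<Pi>\<^sub>M t\<in>J. (borel :: real measure))" for J :: "real set"
    by (rule sets_PiM_cong) auto
  define Y where "Y f \<omega> = (\<lambda>t\<in>?I. f t + B t \<omega>)" for f and \<omega>
  have Y: "Y f \<in> measurable M ?N" for f
    unfolding Y_def by (intro measurable_restrict borel_measurable_add Bm) auto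
  define D where "D f = distr M ?N (Y f)" for f
  have fin: "finite_measure (D f)" for f
    unfolding D_def using Y by (intro prob_space.finite_measure prob_space_distr)
  interpret D: finite_measure "D f" for f by (rule fin)
  have setsD: "sets (D f) = sigma_sets (space (Pi\<^sub>M ?I (\<lambda>_. return borel (0::real)))) R.generator" for f
    using R.sets_PiM_generator cong[of ?I] by (simp add: D_def)
  have D_eq: "measure (D f) C = measure M {\<omega>\<in>space M. (\<lambda>t\<in>?I. f t + B t \<omega>) \<in> C}" if "C \<in> sets ?N" for f C
    using that Y[of f] by (simp add: D_def measure_distr Y_def vimage_def Int_def conj_commute)
  let ?\<epsilon> = "exp (- s * \<kappa> + s * (1 + s) / 2 * E)"
  have gen: "measure (D f1) C \<le> exp \<kappa> * measure (D f0) C + ?\<epsilon>" if "C \<in> R.generator" for C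
    using that
  proof cases
    case (1 J X)
    have CN: "C \<in> sets ?N"
      using that R.sets_PiM_generator cong[of ?I] by auto
    have X: "X \<in> sets (\<Pi>\<^sub>M t\<in>J. borel)" using 1 cong[of J] by simp
    have "(\<lambda>t\<in>?I. f t + B t \<omega>) \<in> C \<longleftrightarrow> (\<lambda>t\<in>J. f t + B t \<omega>) \<in> X" for f \<omega>
    proof -
      have "restrict (\<lambda>t\<in>?I. f t + B t \<omega>) J = (\<lambda>t\<in>J. f t + B t \<omega>)"
        using 1(3) by (auto simp: restrict_def fun_eq_iff)
      then show ?thesis by (simp add: 1(1) prod_emb_def)
    qed
    then show ?thesis
      using cylinder_shift_bound[OF bm T y E f 1(2,3) X s, where \<kappa> = \<kappa>] by (simp add: D_eq[OF CN])
  qed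
  \<comment> \<open>Exchanging \<open>A\<close> for a cylinder costs \<open>e\<close> under the
    shifted law, and \<open>e\<close> under the reference law, where the factor
    \<open>exp \<kappa>\<close> multiplies it.\<close>
  have approx: "measure (D f1) A \<le> exp \<kappa> * measure (D f0) A + ?\<epsilon> + (1 + exp \<kappa>) * e" if e: "e > 0" for e
  proof -
    obtain C where C: "C \<in> R.generator"
      "measure (D f1) (A - C \<union> (C - A)) < e" "measure (D f0) (A - C \<union> (C - A)) < e"
      using symmetric_difference_approximation[OF fin setsD fin setsD R.algebra_generator _ e, of A] A
      unfolding R.sets_PiM_generator[symmetric] cong by blast
    have CN: "C \<in> sets ?N"
      using C(1) R.sets_PiM_generator cong[of ?I] by auto
    have sets: "A \<in> sets (D f)" "C \<in> sets (D f)" for f using A CN by (simp_all add: D_def)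
    have diff: "measure (D f) A' \<le> measure (D f) C' + measure (D f) (A' - C' \<union> (C' - A'))"
      if "A' \<in> sets (D f)" "C' \<in> sets (D f)" for f A' C'
    proof -
      have "measure (D f) A' \<le> measure (D f) (C' \<union> (A' - C' \<union> (C' - A')))"
        using that by (intro D.finite_measure_mono) auto
      also have "\<dots> \<le> measure (D f) C' + measure (D f) (A' - C' \<union> (C' - A'))"
        using that by (intro measure_Un_le) auto
      finally show ?thesis .
    qed
    have "measure (D f1) A \<le> measure (D f1) C + e"
      using diff[OF sets(1,2), of f1] C(2) by simp
    also have "measure (D f1) C \<le> exp \<kappa> * measure (D f0) C + ?\<epsilon>"
      by (rule gen) (rule C)
    also have "measure (D f0) C \<le> measure (D f0) A + e"
      using diff[OF sets(2,1), of f0] C(3) by (simp add: Un_commute)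
    finally show ?thesis by (simp add: algebra_simps)
  qed
  have "measure (D f1) A \<le> exp \<kappa> * measure (D f0) A + ?\<epsilon>"
  proof (rule field_le_epsilon)
    fix e :: real assume "e > 0"
    moreover have pos: "1 + exp \<kappa> > 0" by (simp add: add_pos_pos)
    ultimately have "e / (1 + exp \<kappa>) > 0" by simp
    from approx[OF this] pos show "measure (D f1) A \<le> exp \<kappa> * measure (D f0) A + ?\<epsilon> + e" by simp
  qed
  then show ?thesis using A by (simp add: D_eq)
qed

section \<open>Messages and error probability\<close>

lemma finite_messages [simp]: "finite (messages T r)"
  by (simp add: messages_def)

lemma card_messages: "card (messages T r) = nat \<lfloor>exp (T * r)\<rfloor>"
  by (simp add: messages_def)

lemma one_in_messages: "T > 0 \<Longrightarrow> r \<ge> 0 \<Longrightarrow> 1 \<in> messages T r"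
  by (simp add: messages_def le_nat_iff le_floor_iff)

lemma card_messages_pos: "T > 0 \<Longrightarrow> r \<ge> 0 \<Longrightarrow> card (messages T r) > 0"
  using one_in_messages[of T r] by (auto simp: card_gt_0_iff)

lemma finite_message_tuples [simp]: "finite (message_tuples T R)"
  by (simp add: message_tuples_def finite_PiE)

text \<open>Every message tuple is an atom. Hence conditioning on a tuple never divides by zero, and
  an almost sure property of the tuple holds for each tuple.\<close>

lemma message_law_singleton:
  fixes R :: "real^'m::finite"
  assumes T: "T > 0" and R: "\<And>i. R $ i \<ge> 0" and w: "w \<in> message_tuples T R"
  shows "prob_space (message_law T R)" "space (message_law T R) = message_tuples T R"
    "{w} \<in> sets (message_law T R)" "measure (message_law T R) {w} > 0"
proof -
  have prob: "prob_space (uniform_count_measure (messages T (R $ i)))" for i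
    using one_in_messages[OF T R] by (intro prob_space_uniform_count_measure) auto
  interpret product_prob_space "\<lambda>i. uniform_count_measure (messages T (R $ i))" UNIV
    by (rule product_prob_spaceI) (rule prob)
  show p: "prob_space (message_law T R)" unfolding message_law_def by (rule prob_space_axioms)
  show sp: "space (message_law T R) = message_tuples T R"
    by (simp add: message_law_def space_PiM message_tuples_def space_uniform_count_measure)
  have wi: "w i \<in> messages T (R $ i)" for i using w by (auto simp: message_tuples_def)
  have eq: "{w} = (\<Pi>\<^sub>E i\<in>UNIV. {w i})" by (auto simp: PiE_iff)
  show "{w} \<in> sets (message_law T R)"
    unfolding message_law_def eq by (intro sets_PiM_I_finite) (auto simp: sets_uniform_count_measure wi)
  have "emeasure (message_law T R) {w} = (\<Prod>i\<in>UNIV. emeasure (uniform_count_measure (messages T (R $ i))) {w i})"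
    unfolding message_law_def eq by (intro emeasure_PiM) (auto simp: sets_uniform_count_measure wi)
  also have "\<dots> = (\<Prod>i\<in>UNIV. ennreal (1 / card (messages T (R $ i))))"
    using wi by (intro prod.cong refl) (simp add: emeasure_uniform_count_measure)
  also have "\<dots> = ennreal (\<Prod>i\<in>UNIV. 1 / card (messages T (R $ i)))"
    by (intro prod_ennreal) simp
  finally have "measure (message_law T R) {w} = (\<Prod>i\<in>UNIV. 1 / card (messages T (R $ i)))"
    by (simp add: measure_def prod_nonneg)
  also have "\<dots> > 0"
    using card_messages_pos[OF T R] by (intro prod_pos) simp
  finally show "measure (message_law T R) {w} > 0" .
qed

section \<open>Output paths for fixed messages\<close>

definition mean_output ::
  "real^'m^'m \<Rightarrow> ('m \<Rightarrow> nat \<Rightarrow> real \<Rightarrow> real) \<Rightarrow> 'm::finite \<Rightarrow> ('m \<Rightarrow> nat) \<Rightarrow> real \<Rightarrow> real" where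
  "mean_output a X i w t = (\<Sum>j\<in>UNIV. a $ i $ j * integral {0..t} (X j (w j)))"

lemma output_path_eq:
  "output_path a B X T i (w, \<omega>) = (\<lambda>t\<in>{0..T}. mean_output a X i w t + B i t \<omega>)"
  by (simp add: output_path_def channel_output_def mean_output_def)

lemma continuous_on_integral_C_interval:
  "x \<in> C_interval T \<Longrightarrow> continuous_on {0..T} (\<lambda>t. integral {0..t} x)"
  by (intro indefinite_integral_continuous_1 integrable_continuous_real) (simp add: C_interval_def)

lemma path_in_C_measurable_space:
  assumes bm: "standard_brownian_motion M B" and f: "continuous_on {0..T} f"
  shows "(\<lambda>\<omega>. \<lambda>t\<in>{0..T}. f t + B t \<omega>) \<in> M \<rightarrow>\<^sub>M C_measurable_space T"
  unfolding C_measurable_space_def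
proof (rule measurable_restrict_space2)
  show "(\<lambda>\<omega>. \<lambda>t\<in>{0..T}. f t + B t \<omega>) \<in> M \<rightarrow>\<^sub>M (\<Pi>\<^sub>M t\<in>{0..T}. borel)"
    using bm by (intro measurable_restrict borel_measurable_add) (auto simp: standard_brownian_motion_def)
  show "(\<lambda>\<omega>. \<lambda>t\<in>{0..T}. f t + B t \<omega>) \<in> space M \<rightarrow> C_interval T"
  proof
    fix \<omega> assume "\<omega> \<in> space M"
    then have "continuous_on {0..} (\<lambda>t. B t \<omega>)" using bm by (simp add: standard_brownian_motion_def)
    then have "continuous_on {0..T} (\<lambda>t. B t \<omega>)" by (rule continuous_on_subset) auto
    with f have "continuous_on {0..T} (\<lambda>t. f t + B t \<omega>)" by (intro continuous_on_add)
    then have "continuous_on {0..T} (\<lambda>t\<in>{0..T}. f t + B t \<omega>)"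
      by (rule continuous_on_eq) auto
    then show "(\<lambda>t\<in>{0..T}. f t + B t \<omega>) \<in> C_interval T" by (simp add: C_interval_def)
  qed
qed

lemma code_input_in_C_interval:
  "is_code T R P X g \<Longrightarrow> w \<in> message_tuples T R \<Longrightarrow> X j (w j) \<in> C_interval T"
  unfolding is_code_def message_tuples_def
  by (elim conjE, drule spec[of _ j], erule funcset_mem) auto

lemma continuous_on_mean_output:
  "is_code T R P X g \<Longrightarrow> w \<in> message_tuples T R \<Longrightarrow> continuous_on {0..T} (mean_output a X i w)"
  unfolding mean_output_def[abs_def]
  by (intro continuous_intros continuous_on_integral_C_interval code_input_in_C_interval)

lemma decoder_event:
  assumes bm: "standard_brownian_motion M B" and f: "continuous_on {0..T} f"
    and g: "is_code T R P X g"
  shows "{\<omega>\<in>space M. g i (\<lambda>t\<in>{0..T}. f t + B t \<omega>) = k} \<in> sets M"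
proof -
  have "(\<lambda>\<omega>. g i (\<lambda>t\<in>{0..T}. f t + B t \<omega>)) \<in> M \<rightarrow>\<^sub>M count_space (messages T (R $ i))"
    using g by (intro measurable_compose[OF path_in_C_measurable_space[OF bm f]]) (simp add: is_code_def)
  \<comment> \<open>Enlarging the codomain makes equality with any \<open>k\<close> an event, also
    for \<open>k\<close> outside the alphabet.\<close>
  then have [measurable]: "(\<lambda>\<omega>. g i (\<lambda>t\<in>{0..T}. f t + B t \<omega>)) \<in> M \<rightarrow>\<^sub>M count_space UNIV"
    by (rule measurable_compose) simp
  show ?thesis by measurable
qed

lemma error_event:
  assumes bm: "\<And>i. standard_brownian_motion M (B i)" and code: "is_code T R P X g"
    and w: "w \<in> message_tuples T R"
  shows "{\<omega>\<in>space M. \<exists>i::'m::finite. g i (output_path a B X T i (w, \<omega>)) \<noteq> w i} \<in> sets M"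
proof -
  have "{\<omega>\<in>space M. \<exists>i. g i (output_path a B X T i (w, \<omega>)) \<noteq> w i} =
      (\<Union>i. space M - {\<omega>\<in>space M. g i (\<lambda>t\<in>{0..T}. mean_output a X i w t + B i t \<omega>) = w i})"
    by (auto simp: output_path_eq)
  also have "\<dots> \<in> sets M"
    using decoder_event[OF bm continuous_on_mean_output[OF code w] code] by (intro sets.finite_UN) auto
  finally show ?thesis .
qed

text \<open>On the product space, both the error event and the conditioning event over
  \<open>w\<close> are rectangles with first side \<open>{w}\<close>. The mass of this atom cancels,
  leaving a probability of the noise alone.\<close>

lemma error_probability_eq:
  assumes M: "prob_space M" and bm: "\<And>i. standard_brownian_motion M (B i)"
    and code: "is_code T R P X g"
  shows "error_probability M B a T R X g =
     (\<Sum>w\<in>message_tuples T R. measure M {\<omega>\<in>space M. \<exists>i::'m::finite. g i (output_path a B X T i (w, \<omega>)) \<noteq> w i}) /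
       card (message_tuples T R)"
proof -
  interpret prob_space M by fact
  have T: "T > 0" and R: "\<And>i. R $ i \<ge> 0" using code by (auto simp: is_code_def)
  let ?E = "\<lambda>w. {\<omega>\<in>space M. \<exists>i. g i (output_path a B X T i (w, \<omega>)) \<noteq> w i}"
  have "\<P>(z in message_law T R \<Otimes>\<^sub>M M. (\<exists>i. g i (output_path a B X T i z) \<noteq> fst z i) \<bar> fst z = w) = measure M (?E w)"
    if w: "w \<in> message_tuples T R" for w
  proof -
    note law = message_law_singleton[OF T R w]
    have E: "?E w \<in> sets M" using error_event[OF bm code w] .
    have times: "measure (message_law T R \<Otimes>\<^sub>M M) ({w} \<times> S) = measure (message_law T R) {w} * measure M S"
      if "S \<in> sets M" for S
      using emeasure_pair_measure_Times[OF law(3) that] by (simp add: measure_def enn2real_mult)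
    have "{z \<in> space (message_law T R \<Otimes>\<^sub>M M). (\<exists>i. g i (output_path a B X T i z) \<noteq> fst z i) \<and> fst z = w} = {w} \<times> ?E w"
      using w by (auto simp: space_pair_measure law(2))
    moreover have "{z \<in> space (message_law T R \<Otimes>\<^sub>M M). fst z = w} = {w} \<times> space M"
      using w by (auto simp: space_pair_measure law(2))
    ultimately show ?thesis
      using times[OF E] times[OF sets.top] law(4) by (simp add: cond_prob_def prob_space)
  qed
  then show ?thesis
    by (simp add: error_probability_def message_tuples_def card_PiE)
qed

section \<open>Converse\<close>

text \<open>A violating tuple would be an atom inside a null set.\<close>

lemma code_energy:
  assumes code: "is_code T R P X g" and w: "w \<in> message_tuples T R"
  shows "integral {0..T} (\<lambda>s. (X i (w i) s)\<^sup>2) \<le> P $ i * T"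
proof -
  have T: "T > 0" and R: "\<And>i. R $ i \<ge> 0" using code by (auto simp: is_code_def)
  note law = message_law_singleton[OF T R w]
  interpret prob_space "message_law T R" by (rule law)
  have "AE w in message_law T R. 1 / T * integral {0..T} (\<lambda>s. (X i (w i) s)\<^sup>2) \<le> P $ i"
    using code by (simp add: is_code_def)
  then have "1 / T * integral {0..T} (\<lambda>s. (X i (w i) s)\<^sup>2) \<le> P $ i"
  proof (rule contrapos_pp)
    assume no: "\<not> 1 / T * integral {0..T} (\<lambda>s. (X i (w i) s)\<^sup>2) \<le> P $ i"
    show "\<not> (AE w in message_law T R. 1 / T * integral {0..T} (\<lambda>s. (X i (w i) s)\<^sup>2) \<le> P $ i)"
    proof
      assume "AE w in message_law T R. 1 / T * integral {0..T} (\<lambda>s. (X i (w i) s)\<^sup>2) \<le> P $ i"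
      then have "AE v in message_law T R. v \<notin> {w}"
        by eventually_elim (use no in auto)
      then have "measure (message_law T R) {w} = 0"
        using law(3) by (simp add: prob_eq_0)
      with law(4) show False by simp
    qed
  qed
  then show ?thesis using T by (simp add: field_simps)
qed

text \<open>The reference output is the one with sender \<open>i\<close> silent and all others
  transmitting as before, so the shift is the own code word scaled by the direct gain.\<close>

lemma correct_decoding_bound:
  assumes bm: "standard_brownian_motion M B" and code: "is_code T R P X g"
    and w: "w \<in> message_tuples T R" and s: "s > 0"
  shows "measure M {\<omega>\<in>space M. g i (\<lambda>t\<in>{0..T}. mean_output a X i w t + B t \<omega>) = k} \<le>
    exp \<kappa> * measure M {\<omega>\<in>space M. g i (\<lambda>t\<in>{0..T}.
      (\<Sum>j\<in>UNIV - {i}. a $ i $ j * integral {0..t} (X j (w j))) + B t \<omega>) = k} +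
    exp (- s * \<kappa> + s * (1 + s) / 2 * ((a $ i $ i)\<^sup>2 * P $ i * T))"
proof -
  have T: "T > 0" using code by (auto simp: is_code_def)
  let ?f0 = "\<lambda>t. \<Sum>j\<in>UNIV - {i}. a $ i $ j * integral {0..t} (X j (w j))"
  let ?f1 = "mean_output a X i w"
  let ?y = "\<lambda>s. a $ i $ i * X i (w i) s"
  have c0: "continuous_on {0..T} ?f0"
    by (intro continuous_intros continuous_on_integral_C_interval code_input_in_C_interval[OF code w])
  have c1: "continuous_on {0..T} ?f1" by (rule continuous_on_mean_output[OF code w])
  have "continuous_on {0..T} (X i (w i))"
    using code_input_in_C_interval[OF code w, of i] by (simp add: C_interval_def)
  then have y: "continuous_on {0..T} ?y" by (intro continuous_intros)
  have E: "integral {0..T} (\<lambda>s. (?y s)\<^sup>2) \<le> (a $ i $ i)\<^sup>2 * P $ i * T"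
    using mult_left_mono[OF code_energy[OF code w, of i], of "(a $ i $ i)\<^sup>2"]
    by (simp add: power_mult_distrib mult.assoc)
  have f: "?f1 t = ?f0 t + integral {0..t} ?y" for t
    by (simp add: mean_output_def sum.remove[of UNIV i])
  have "{x \<in> space (C_measurable_space T). g i x = k} \<in> sets (C_measurable_space T)"
  proof -
    have "g i \<in> C_measurable_space T \<rightarrow>\<^sub>M count_space (messages T (R $ i))"
      using code by (simp add: is_code_def)
    then have [measurable]: "g i \<in> C_measurable_space T \<rightarrow>\<^sub>M count_space UNIV"
      by (rule measurable_compose) simp
    show ?thesis by measurable
  qed
  \<comment> \<open>An event in C[0,T] is only the trace of a product-measurable set, since C[0,T]
    itself is not product-measurable. As all output paths are continuous, \<open>A\<close> and its
    trace contain the same outputs.\<close>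
  then obtain A where A: "A \<in> sets (\<Pi>\<^sub>M t\<in>{0..T}. (borel :: real measure))"
    and AC: "{x \<in> space (C_measurable_space T). g i x = k} = C_interval T \<inter> A"
    by (auto simp: C_measurable_space_def sets_restrict_space)
  have ev: "{\<omega>\<in>space M. g i (\<lambda>t\<in>{0..T}. f t + B t \<omega>) = k} = {\<omega>\<in>space M. (\<lambda>t\<in>{0..T}. f t + B t \<omega>) \<in> A}"
    if "continuous_on {0..T} f" for f
  proof (intro Collect_cong conj_cong refl)
    fix \<omega> assume "\<omega> \<in> space M"
    then have sp: "(\<lambda>t\<in>{0..T}. f t + B t \<omega>) \<in> space (C_measurable_space T)"
      by (rule measurable_space[OF path_in_C_measurable_space[OF bm that]])
    then have "(\<lambda>t\<in>{0..T}. f t + B t \<omega>) \<in> C_interval T"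
      by (simp add: C_measurable_space_def space_restrict_space)
    then show "g i (\<lambda>t\<in>{0..T}. f t + B t \<omega>) = k \<longleftrightarrow> (\<lambda>t\<in>{0..T}. f t + B t \<omega>) \<in> A"
      using AC sp by blast
  qed
  show ?thesis
    unfolding ev[OF c0] ev[OF c1] by (rule path_shift_bound[OF bm T y E f A s])
qed

text \<open>With sender \<open>i\<close> silent the output carries no information on message
  \<open>i\<close>. For fixed other messages the decisions of decoder \<open>i\<close> are disjoint
  events, so it is right with average probability at most \<open>1 / card ?K\<close>; the code word
  can raise this by the factor \<open>exp \<kappa>\<close> and the additive term only.\<close>

lemma converse_bound:
  assumes M: "prob_space M" and bm: "\<And>i. standard_brownian_motion M (B i)"
    and code: "is_code T R P X g" and s: "s > 0"
  shows "(1 - error_probability M B a T R X g -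
      exp (- s * \<kappa> + s * (1 + s) / 2 * ((a $ i $ i)\<^sup>2 * P $ i * T))) *
      card (messages T (R $ i)) \<le> exp \<kappa>"
proof -
  interpret prob_space M by fact
  have T: "T > 0" and R: "\<And>i. R $ i \<ge> 0" using code by (auto simp: is_code_def)
  let ?W = "message_tuples T R" and ?K = "messages T (R $ i)"
  let ?\<epsilon> = "exp (- s * \<kappa> + s * (1 + s) / 2 * ((a $ i $ i)\<^sup>2 * P $ i * T))"
  define f0 where "f0 w t = (\<Sum>j\<in>UNIV - {i}. a $ i $ j * integral {0..t} (X j (w j)))" for w t
  define q where "q w k = prob {\<omega>\<in>space M. g i (\<lambda>t\<in>{0..T}. f0 w t + B i t \<omega>) = k}" for w k
  have card: "real (card ?W) > 0"
    using card_messages_pos[OF T R] by (simp add: message_tuples_def card_PiE prod_pos)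
  have K: "real (card ?K) > 0" using card_messages_pos[OF T R] by simp
  have q_sum: "(\<Sum>k\<in>?K. q w k) \<le> 1" if w: "w \<in> ?W" for w
  proof -
    have c0: "continuous_on {0..T} (f0 w)"
      unfolding f0_def by (intro continuous_intros continuous_on_integral_C_interval code_input_in_C_interval[OF code w])
    have "(\<Sum>k\<in>?K. q w k) = prob (\<Union>k\<in>?K. {\<omega>\<in>space M. g i (\<lambda>t\<in>{0..T}. f0 w t + B i t \<omega>) = k})"
      unfolding q_def using decoder_event[OF bm c0 code]
      by (intro finite_measure_finite_Union[symmetric]) (auto simp: disjoint_family_on_def)
    then show ?thesis by simp
  qed
  have q_upd: "q (w(i := k)) l = q w l" for w k l
    by (simp add: q_def f0_def)
  \<comment> \<open>q w does not depend on w i, so averaging over w i turns q w (w i) into (\<Sum>k. q w k) / card ?K.\<close>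
  have swap: "(\<Sum>(w, k)\<in>?W \<times> ?K. q w (w i)) = (\<Sum>(w, k)\<in>?W \<times> ?K. q w k)"
    by (rule sum.reindex_bij_witness[of _ "\<lambda>(w, k). (w(i := k), w i)" "\<lambda>(w, k). (w(i := k), w i)"])
      (auto simp: message_tuples_def PiE_iff q_upd split: if_splits)
  have "real (card ?K) * (\<Sum>w\<in>?W. q w (w i)) = (\<Sum>w\<in>?W. \<Sum>k\<in>?K. q w k)"
    using swap by (simp add: sum.cartesian_product[symmetric] sum_distrib_left)
  also have "\<dots> \<le> card ?W"
    using sum_mono[OF q_sum] by simp
  finally have q: "(\<Sum>w\<in>?W. q w (w i)) \<le> card ?W / card ?K"
    using K by (simp add: field_simps)
  have correct: "1 - prob {\<omega>\<in>space M. \<exists>i. g i (output_path a B X T i (w, \<omega>)) \<noteq> w i} \<le> exp \<kappa> * q w (w i) + ?\<epsilon>"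
    if w: "w \<in> ?W" for w
  proof -
    let ?C = "{\<omega>\<in>space M. g i (\<lambda>t\<in>{0..T}. mean_output a X i w t + B i t \<omega>) = w i}"
    have C: "?C \<in> events" by (rule decoder_event[OF bm continuous_on_mean_output[OF code w] code])
    \<comment> \<open>A wrong decision of receiver \<open>i\<close> alone is already an error of the
      code, so correct decoding by all implies \<open>?C\<close>.\<close>
    have "1 - prob ?C = prob (space M - ?C)" by (rule prob_compl[OF C, symmetric])
    also have "\<dots> \<le> prob {\<omega>\<in>space M. \<exists>i. g i (output_path a B X T i (w, \<omega>)) \<noteq> w i}"
      by (intro finite_measure_mono error_event[OF bm code w]) (auto simp: output_path_eq)
    finally have "1 - prob {\<omega>\<in>space M. \<exists>i. g i (output_path a B X T i (w, \<omega>)) \<noteq> w i} \<le> prob ?C" by simp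
    also have "\<dots> \<le> exp \<kappa> * q w (w i) + ?\<epsilon>"
      unfolding q_def f0_def by (rule correct_decoding_bound[OF bm code w s])
    finally show ?thesis .
  qed
  have "(1 - error_probability M B a T R X g) * card ?W =
      (\<Sum>w\<in>?W. 1 - prob {\<omega>\<in>space M. \<exists>i. g i (output_path a B X T i (w, \<omega>)) \<noteq> w i})"
    using card by (simp add: error_probability_eq[OF M bm code] sum_subtractf field_simps)
  also have "\<dots> \<le> (\<Sum>w\<in>?W. exp \<kappa> * q w (w i) + ?\<epsilon>)"
    by (rule sum_mono) (rule correct)
  also have "\<dots> = exp \<kappa> * (\<Sum>w\<in>?W. q w (w i)) + card ?W * ?\<epsilon>"
    by (simp add: sum.distrib sum_distrib_left)
  also have "\<dots> \<le> exp \<kappa> * (card ?W / card ?K) + card ?W * ?\<epsilon>"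
    by (intro add_right_mono mult_left_mono q) simp
  finally have "(1 - error_probability M B a T R X g - ?\<epsilon>) * card ?W \<le> exp \<kappa> / card ?K * card ?W"
    by (simp add: algebra_simps)
  then have "1 - error_probability M B a T R X g - ?\<epsilon> \<le> exp \<kappa> / card ?K"
    using card by (simp only: mult_le_cancel_right)
  then show ?thesis using K by (simp add: pos_le_divide_eq)
qed

lemma exp_neg_tendsto_0:
  fixes T :: "nat \<Rightarrow> real"
  assumes "filterlim T at_top sequentially" "c > 0"
  shows "(\<lambda>n. exp (- c * T n)) \<longlonglongrightarrow> 0"
proof -
  have "filterlim (\<lambda>n. c * T n) at_top sequentially"
    using assms by (intro filterlim_tendsto_pos_mult_at_top[OF tendsto_const])
  then have "filterlim (\<lambda>n. - c * T n) at_bot sequentially"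
    by (simp add: filterlim_uminus_at_bot)
  then show ?thesis by (rule filterlim_compose[OF exp_at_bot])
qed

lemma achievable_rate_le:
  assumes M: "prob_space M" and bm: "\<And>i. standard_brownian_motion M (B i)"
    and ach: "achievable M B a P R"
  shows "0 \<le> R $ i" "R $ i \<le> (a $ i $ i)\<^sup>2 * P $ i / 2"
proof -
  obtain T X g where T: "filterlim T at_top sequentially"
    and code: "\<And>n::nat. is_code (T n) R P (X n) (g n)"
    and err: "(\<lambda>n. error_probability M B a (T n) R (X n) (g n)) \<longlonglongrightarrow> 0"
    using ach by (auto simp: achievable_def)
  show R0: "0 \<le> R $ i" using code[of 0] by (simp add: is_code_def)
  have P: "P $ i > 0" using code[of 0] by (simp add: is_code_def)
  show "R $ i \<le> (a $ i $ i)\<^sup>2 * P $ i / 2"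
  proof (rule ccontr)
    define C where "C = (a $ i $ i)\<^sup>2 * P $ i / 2"
    assume "\<not> ?thesis"
    then have RC: "R $ i > C" by (simp add: C_def)
    have C: "C \<ge> 0" using P by (simp add: C_def)
    \<comment> \<open>Half the gap: with \<kappa> equal to \<open>T n * (C + \<delta>)\<close>,
      dividing by the roughly \<open>exp (T n * R $ i)\<close> messages still leaves
      \<open>exp (- \<delta> * T n)\<close>.\<close>
    define \<delta> where "\<delta> = (R $ i - C) / 2"
    \<comment> \<open>The additive term has exponent \<open>s * T n * (s * C - \<delta>)\<close>.
      This choice gives \<open>s * C \<le> \<delta> / 2\<close> and so decay; the \<open>+ 1\<close>
      covers \<open>C = 0\<close>.\<close>
    define s where "s = \<delta> / (2 * C + 1)"
    have \<delta>: "\<delta> > 0" using RC by (simp add: \<delta>_def)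
    have s: "s > 0" using \<delta> C by (simp add: s_def)
    have sC: "s * C \<le> \<delta> / 2" using C \<delta> by (simp add: s_def field_simps)
    \<comment> \<open>The second alternative covers a negative first factor, where the lower bound
      on the number of messages cannot be multiplied in. It fails for large
      \<open>n\<close>.\<close>
    have bound: "(1 - error_probability M B a (T n) R (X n) (g n) - exp (- (s * \<delta> / 2) * T n)) *
        (1 - exp (- (R $ i) * T n)) \<le> exp (- \<delta> * T n) \<or> error_probability M B a (T n) R (X n) (g n) + exp (- (s * \<delta> / 2) * T n) \<ge> 1" for n
    proof -
      let ?e = "error_probability M B a (T n) R (X n) (g n)" and ?\<epsilon> = "exp (- (s * \<delta> / 2) * T n)"
      have Tn: "T n > 0" using code[of n] by (simp add: is_code_def)
      have "- s * (T n * (C + \<delta>)) + s * (1 + s) / 2 * ((a $ i $ i)\<^sup>2 * P $ i * T n) = s * T n * (s * C - \<delta>)"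
        by (simp add: C_def algebra_simps)
      also have "\<dots> \<le> s * T n * (- \<delta> / 2)"
        using sC s Tn by (intro mult_left_mono) auto
      finally have ex: "exp (- s * (T n * (C + \<delta>)) + s * (1 + s) / 2 * ((a $ i $ i)\<^sup>2 * P $ i * T n)) \<le> ?\<epsilon>"
        by (simp add: algebra_simps)
      have "(1 - ?e - ?\<epsilon>) * card (messages (T n) (R $ i)) \<le>
          (1 - ?e - exp (- s * (T n * (C + \<delta>)) + s * (1 + s) / 2 * ((a $ i $ i)\<^sup>2 * P $ i * T n))) *
            card (messages (T n) (R $ i))"
        using ex by (intro mult_right_mono) auto
      also have "\<dots> \<le> exp (T n * (C + \<delta>))"
        by (rule converse_bound[OF M bm code s])
      finally have 1: "(1 - ?e - ?\<epsilon>) * card (messages (T n) (R $ i)) \<le> exp (T n * (C + \<delta>))" .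
      \<comment> \<open>The integer part loses at most 1, which becomes the factor
        \<open>1 - exp (- (R $ i) * T n)\<close>; it tends to 1 because the assumed rate is
        positive.\<close>
      have 2: "real (card (messages (T n) (R $ i))) \<ge> exp (T n * R $ i) - 1"
        by (simp add: card_messages)
      show ?thesis
      proof (cases "1 - ?e - ?\<epsilon> \<ge> 0")
        case True
        have "(1 - ?e - ?\<epsilon>) * (exp (T n * R $ i) - 1) \<le> exp (T n * (C + \<delta>))"
          using mult_left_mono[OF 2 True] 1 by linarith
        then have "(1 - ?e - ?\<epsilon>) * (exp (T n * R $ i) - 1) * exp (- (R $ i) * T n) \<le>
            exp (T n * (C + \<delta>)) * exp (- (R $ i) * T n)"
          by (rule mult_right_mono) simp
        also have "exp (T n * (C + \<delta>)) * exp (- (R $ i) * T n) = exp (- \<delta> * T n)"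
          by (simp add: exp_add[symmetric] \<delta>_def field_simps)
        finally have "(1 - ?e - ?\<epsilon>) * ((exp (T n * R $ i) - 1) * exp (- (R $ i) * T n)) \<le> exp (- \<delta> * T n)"
          by (simp only: mult.assoc)
        moreover have "(exp (T n * R $ i) - 1) * exp (- (R $ i) * T n) = 1 - exp (- (R $ i) * T n)"
          by (simp add: exp_minus field_simps)
        ultimately show ?thesis by simp
      qed simp
    qed
    note lim = exp_neg_tendsto_0[OF T]
    have l1: "(\<lambda>n. 1 - error_probability M B a (T n) R (X n) (g n) - exp (- (s * \<delta> / 2) * T n)) \<longlonglongrightarrow> 1 - 0 - 0"
      using s \<delta> by (intro tendsto_diff tendsto_const err lim) simp
    then have "eventually (\<lambda>n. 1 - error_probability M B a (T n) R (X n) (g n) - exp (- (s * \<delta> / 2) * T n) > 0) sequentially"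
      by (rule order_tendstoD) simp
    then have "eventually (\<lambda>n. (1 - error_probability M B a (T n) R (X n) (g n) - exp (- (s * \<delta> / 2) * T n)) *
        (1 - exp (- (R $ i) * T n)) \<le> exp (- \<delta> * T n)) sequentially"
      by eventually_elim (use bound in force)
    moreover have "(\<lambda>n. (1 - error_probability M B a (T n) R (X n) (g n) - exp (- (s * \<delta> / 2) * T n)) *
        (1 - exp (- (R $ i) * T n))) \<longlonglongrightarrow> (1 - 0 - 0) * (1 - 0)"
      using RC C by (intro tendsto_mult l1 tendsto_diff tendsto_const lim) simp
    ultimately have "(1 - 0 - 0) * (1 - 0 :: real) \<le> 0"
      by (intro tendsto_le[OF _ lim[OF \<delta>]]) auto
    then show False by simp
  qed
qed

section \<open>Achievability\<close>

text \<open>For arguments from \<open>b\<close> on, the centred density is at most the stated factor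
  times the density with mean \<open>b\<close>, whose mass is 1. The sign \<open>c\<close> gives
  both tails at once, as needed for gains of either sign.\<close>

lemma (in prob_space) normal_tail_bound:
  assumes X: "distributed M lborel X (normal_density 0 \<sigma>)" and \<sigma>: "\<sigma> > 0"
    and c: "\<bar>c\<bar> = 1" and b: "b \<ge> 0"
  shows "prob {\<omega>\<in>space M. b \<le> c * X \<omega>} \<le> exp (- b\<^sup>2 / (2 * \<sigma>\<^sup>2))"
proof -
  have "distributed M lborel (\<lambda>\<omega>. 0 + c * X \<omega>) (normal_density (0 + c * 0) (\<bar>c\<bar> * \<sigma>))"
    by (rule normal_density_affine[OF X \<sigma>]) (use c in auto)
  then have cX: "distributed M lborel (\<lambda>\<omega>. c * X \<omega>) (normal_density 0 \<sigma>)"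
    using c by simp
  have le: "normal_density 0 \<sigma> x \<le> exp (- b\<^sup>2 / (2 * \<sigma>\<^sup>2)) * normal_density b \<sigma> x" if "b \<le> x" for x
  proof -
    have "b * b \<le> x * b" using that b by (intro mult_right_mono) auto
    then have "0 \<le> (x * b - b\<^sup>2) / \<sigma>\<^sup>2" by (simp add: power2_eq_square)
    also have "(x * b - b\<^sup>2) / \<sigma>\<^sup>2 = - b\<^sup>2 / (2 * \<sigma>\<^sup>2) + (x * b - b\<^sup>2 / 2) / \<sigma>\<^sup>2"
      using \<sigma> by (simp add: field_simps)
    finally have "1 \<le> exp (- b\<^sup>2 / (2 * \<sigma>\<^sup>2) + (x * b - b\<^sup>2 / 2) / \<sigma>\<^sup>2)" by simp
    then have "1 * normal_density 0 \<sigma> x \<le>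
        exp (- b\<^sup>2 / (2 * \<sigma>\<^sup>2) + (x * b - b\<^sup>2 / 2) / \<sigma>\<^sup>2) * normal_density 0 \<sigma> x"
      by (rule mult_right_mono) simp
    also have "\<dots> = exp (- b\<^sup>2 / (2 * \<sigma>\<^sup>2)) * normal_density b \<sigma> x"
      using normal_density_tilt[OF \<sigma>, of 1 x b] by (simp only: exp_add mult.assoc) simp
    finally show ?thesis by simp
  qed
  have "emeasure M {\<omega>\<in>space M. b \<le> c * X \<omega>} = emeasure M ((\<lambda>\<omega>. c * X \<omega>) -` {b..} \<inter> space M)"
    by (rule arg_cong[where f = "emeasure M"]) auto
  also have "\<dots> = (\<integral>\<^sup>+x. ennreal (normal_density 0 \<sigma> x) * indicator {b..} x \<partial>lborel)"
    by (rule distributed_emeasure[OF cX]) simp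
  also have "\<dots> \<le> (\<integral>\<^sup>+x. ennreal (exp (- b\<^sup>2 / (2 * \<sigma>\<^sup>2))) * ennreal (normal_density b \<sigma> x) \<partial>lborel)"
    by (rule nn_integral_mono) (use le in \<open>auto simp: indicator_def ennreal_mult[symmetric] intro!: ennreal_leI\<close>)
  also have "\<dots> = ennreal (exp (- b\<^sup>2 / (2 * \<sigma>\<^sup>2)))"
    using \<sigma> by (simp add: nn_integral_cmult nn_integral_normal_density)
  finally show ?thesis by (simp add: emeasure_eq_measure)
qed

text \<open>Channel inputs are continuous, so a rectangular pulse on [u, u + d] is not available. This
  pulse has height at most 1, vanishes outside [u, u + d], and tends to the rectangular one as
  K grows.\<close>

definition pulse :: "nat \<Rightarrow> real \<Rightarrow> real \<Rightarrow> real \<Rightarrow> real" where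
  "pulse K u d s = max 0 (1 - (2 * (s - u) / d - 1) ^ (2 * K))"

lemma continuous_on_pulse: "continuous_on S (pulse K u d)"
proof -
  have "continuous_on S (\<lambda>s. max 0 (1 - (2 * (s - u) * inverse d - 1) ^ (2 * K)))"
    by (intro continuous_intros)
  then show ?thesis by (simp add: pulse_def[abs_def] divide_inverse)
qed

lemma pulse_bounds: "0 \<le> pulse K u d s" "pulse K u d s \<le> 1"
  by (simp_all add: pulse_def zero_le_even_power)

lemma pulse_outside:
  assumes "d > 0" "s \<le> u \<or> u + d \<le> s"
  shows "pulse K u d s = 0"
proof -
  have "1 \<le> \<bar>2 * (s - u) / d - 1\<bar>"
    using assms by (auto simp: field_simps abs_if)
  then have "1 \<le> \<bar>2 * (s - u) / d - 1\<bar> ^ (2 * K)" by (rule one_le_power)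
  then show ?thesis by (simp add: pulse_def power_even_abs)
qed

text \<open>The substitution \<open>2 * (s - u) / d - 1\<close> maps the slot to [-1, 1], where 1 -
  z^(2K) has integral 2 - 2/(2K + 1); rescaling multiplies by d/2. The relative loss against a
  rectangle is thus 1/(2K + 1).\<close>

lemma integral_pulse:
  assumes d: "d > 0"
  shows "integral {u..u + d} (pulse K u d) = d * (1 - 1 / (2 * real K + 1))"
proof -
  let ?z = "\<lambda>s. 2 * (s - u) / d - 1"
  let ?F = "\<lambda>s. s - d / 2 * (?z s ^ (2 * K + 1) / (2 * real K + 1))"
  have "((\<lambda>s. 1 - ?z s ^ (2 * K)) has_integral ?F (u + d) - ?F u) {u..u + d}"
  proof (rule fundamental_theorem_of_calculus)
    fix s
    have z: "(?z has_real_derivative 2 / d) (at s within {u..u + d})"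
      using d by (auto intro!: derivative_eq_intros)
    have "((\<lambda>s. ?z s ^ (2 * K + 1)) has_real_derivative real (2 * K + 1) * ?z s ^ (2 * K) * (2 / d))
        (at s within {u..u + d})"
      using DERIV_power[OF z, of "2 * K + 1"] by (simp add: mult_ac)
    from DERIV_diff[OF DERIV_ident DERIV_cmult[OF DERIV_cdivide[OF this]]]
    have "(?F has_real_derivative 1 - d / 2 * ((real (2 * K + 1) * ?z s ^ (2 * K) * (2 / d)) / (2 * real K + 1)))
        (at s within {u..u + d})" .
    also have "1 - d / 2 * ((real (2 * K + 1) * ?z s ^ (2 * K) * (2 / d)) / (2 * real K + 1)) = 1 - ?z s ^ (2 * K)"
    proof -
      have "d / 2 * ((n * z * (2 / d)) / n) = z" if "n \<noteq> 0" for n z using d that by simp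
      from this[of "2 * real K + 1" "?z s ^ (2 * K)"] show ?thesis by (simp add: add.commute)
    qed
    finally show "(?F has_vector_derivative 1 - ?z s ^ (2 * K)) (at s within {u..u + d})"
      by (simp add: has_real_derivative_iff_has_vector_derivative)
  qed (use d in simp)
  moreover have "?F (u + d) - ?F u = d * (1 - 1 / (2 * real K + 1))"
  proof -
    have z: "?z (u + d) = 1" "?z u = - 1" using d by simp_all
    have "(u + d - d / 2 * x) - (u - d / 2 * (- x)) = d * (1 - x)" for x by (simp add: field_simps)
    from this[of "1 / (2 * real K + 1)"] show ?thesis unfolding z by simp
  qed
  moreover have "1 - ?z s ^ (2 * K) = pulse K u d s" if "s \<in> {u..u + d}" for s
  proof -
    have "\<bar>?z s\<bar> \<le> 1" using d that by (auto simp: field_simps abs_if)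
    then have "\<bar>?z s\<bar> ^ (2 * K) \<le> 1" by (intro power_le_one) auto
    then show ?thesis by (simp add: pulse_def power_even_abs)
  qed
  ultimately have "(pulse K u d has_integral d * (1 - 1 / (2 * real K + 1))) {u..u + d}"
    by (metis (no_types, lifting) has_integral_eq)
  then show ?thesis by (rule integral_unique)
qed

lemma integral_pulse_disjoint:
  assumes "d > 0" "v + d \<le> u \<or> u + d \<le> v"
  shows "integral {v..v + d} (pulse K u d) = 0"
proof -
  have "integral {v..v + d} (pulse K u d) = integral {v..v + d} (\<lambda>_. 0)"
    by (rule integral_cong) (use assms in \<open>auto intro!: pulse_outside\<close>)
  then show ?thesis by simp
qed

lemma energy_pulse:
  assumes d: "d > 0" and u: "0 \<le> u" "u + d \<le> T"
  shows "integral {0..T} (\<lambda>s. (A * pulse K u d s)\<^sup>2) \<le> A\<^sup>2 * d"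
proof -
  let ?f = "\<lambda>s. (A * pulse K u d s)\<^sup>2"
  have int: "?f integrable_on {u..u + d}"
    by (intro integrable_continuous_real continuous_intros continuous_on_pulse)
  have "(?f has_integral integral {u..u + d} ?f) {0..T}"
    by (rule has_integral_on_superset[OF integrable_integral[OF int]])
      (use d u in \<open>auto simp: pulse_outside not_le\<close>)
  then have "integral {0..T} ?f = integral {u..u + d} ?f" by (rule integral_unique)
  also have "\<dots> \<le> integral {u..u + d} (\<lambda>_. A\<^sup>2)"
  proof (rule integral_le[OF int])
    fix s
    have "(pulse K u d s)\<^sup>2 \<le> 1" using pulse_bounds[of K u d s] by (intro power_le_one) auto
    then show "?f s \<le> A\<^sup>2" by (simp add: power_mult_distrib mult_left_le)
  qed (intro integrable_continuous_real continuous_on_const)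
  also have "\<dots> = A\<^sup>2 * d" using d by simp
  finally show ?thesis .
qed

text \<open>The factor \<open>c\<close> will be the sign of the direct gain, so that a received
  pulse always counts upwards. The default 1 lies in every alphabet of a code. How ties are broken
  is immaterial for the error analysis: a second exceedance is counted as an error anyway.\<close>

definition threshold_decoder ::
  "nat set \<Rightarrow> (nat \<Rightarrow> real) \<Rightarrow> real \<Rightarrow> real \<Rightarrow> real \<Rightarrow> (real \<Rightarrow> real) \<Rightarrow> nat" where
  "threshold_decoder A u d c \<tau> y =
     (if \<exists>k\<in>A. \<tau> < c * (y (u k + d) - y (u k))
      then LEAST k. k \<in> A \<and> \<tau> < c * (y (u k + d) - y (u k)) else 1)"

lemma threshold_decoder_in: "1 \<in> A \<Longrightarrow> threshold_decoder A u d c \<tau> y \<in> A"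
  using LeastI[of "\<lambda>k. k \<in> A \<and> \<tau> < c * (y (u k + d) - y (u k))"]
  by (auto simp: threshold_decoder_def)

lemma threshold_decoder_error:
  assumes "k \<in> A" "threshold_decoder A u d c \<tau> y \<noteq> k"
  shows "c * (y (u k + d) - y (u k)) \<le> \<tau> \<or> (\<exists>l\<in>A - {k}. \<tau> < c * (y (u l + d) - y (u l)))"
proof (rule ccontr)
  let ?Q = "\<lambda>k. \<tau> < c * (y (u k + d) - y (u k))"
  assume "\<not> ?thesis"
  then have k: "?Q k" and l: "\<And>l. l \<in> A \<Longrightarrow> ?Q l \<Longrightarrow> l = k"
    unfolding de_Morgan_disj not_le by blast+
  have "threshold_decoder A u d c \<tau> y = (LEAST k. k \<in> A \<and> ?Q k)"
    unfolding threshold_decoder_def using assms(1) k by (intro if_P) blast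
  also have "\<dots> = k"
  proof (rule Least_equality)
    show "k \<in> A \<and> ?Q k" using assms(1) k by blast
    show "k \<le> m" if "m \<in> A \<and> ?Q m" for m using l[of m] that by blast
  qed
  finally show False using assms(2) by contradiction
qed

lemma threshold_decoder_measurable:
  assumes A: "finite A" "1 \<in> A" and d: "d \<ge> 0"
    and u: "\<And>k. k \<in> A \<Longrightarrow> 0 \<le> u k" "\<And>k. k \<in> A \<Longrightarrow> u k + d \<le> T"
  shows "threshold_decoder A u d c \<tau> \<in> C_measurable_space T \<rightarrow>\<^sub>M count_space A"
proof -
  have ev: "(\<lambda>y. y t) \<in> borel_measurable (C_measurable_space T)" if "t \<in> {0..T}" for t
    unfolding C_measurable_space_def
    by (intro measurable_restrict_space1 measurable_component_singleton that)
  \<comment> \<open>For \<open>k\<close> outside \<open>A\<close> the slot may leave [0,T]; the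
    conjunct \<open>k \<in> A\<close> then makes the predicate constantly false and keeps it
    measurable.\<close>
  have [measurable]: "Measurable.pred (C_measurable_space T) (\<lambda>y. k \<in> A \<and> \<tau> < c * (y (u k + d) - y (u k)))" for k
  proof (cases "k \<in> A")
    case True
    have [measurable]: "(\<lambda>y. y (u k + d)) \<in> borel_measurable (C_measurable_space T)"
      "(\<lambda>y. y (u k)) \<in> borel_measurable (C_measurable_space T)"
      using u[OF True] d by (auto intro!: ev)
    show ?thesis by measurable
  qed simp
  have "Measurable.pred (C_measurable_space T) (\<lambda>y. \<exists>k\<in>A. k \<in> A \<and> \<tau> < c * (y (u k + d) - y (u k)))"
    using A(1) by measurable
  then have [measurable]: "Measurable.pred (C_measurable_space T) (\<lambda>y. \<exists>k\<in>A. \<tau> < c * (y (u k + d) - y (u k)))"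
    by (simp cong: bex_cong)
  have [measurable]: "threshold_decoder A u d c \<tau> \<in> C_measurable_space T \<rightarrow>\<^sub>M count_space UNIV"
    unfolding threshold_decoder_def[abs_def] by measurable
  show ?thesis
    unfolding measurable_count_space_eq2[OF A(1)]
  proof (intro conjI ballI)
    show "threshold_decoder A u d c \<tau> \<in> space (C_measurable_space T) \<rightarrow> A"
      using threshold_decoder_in[OF A(2)] by auto
    show "threshold_decoder A u d c \<tau> -` {a} \<inter> space (C_measurable_space T) \<in> sets (C_measurable_space T)" for a
      by measurable
  qed
qed

section \<open>The pulse position code and its error\<close>

lemma mean_output_increment:
  assumes X: "\<And>j. X j (w j) \<in> C_interval T" and uv: "0 \<le> u" "u \<le> v" "v \<le> T"
  shows "mean_output a X i w v - mean_output a X i w u = (\<Sum>j\<in>UNIV. a $ i $ j * integral {u..v} (X j (w j)))"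
proof -
  have "integral {0..v} (X j (w j)) = integral {0..u} (X j (w j)) + integral {u..v} (X j (w j))" for j
  proof -
    have "continuous_on {0..v} (X j (w j))"
      using X[of j] uv by (auto simp: C_interval_def intro: continuous_on_subset)
    then show ?thesis
      using uv by (intro Henstock_Kurzweil_Integration.integral_combine[symmetric] integrable_continuous_real) auto
  qed
  then show ?thesis
    by (simp add: mean_output_def sum_subtractf[symmetric] algebra_simps)
qed

lemma card_messages_le: "real (card (messages T r)) \<le> exp (T * r)"
  by (simp add: card_messages)

text \<open>In units of \<open>sqrt (T * d)\<close>, \<open>sqrt (2 * \<rho> i)\<close> is the
  threshold, \<open>\<kappa> i\<close> the margin by which the signal exceeds it, and
  \<open>K i\<close> controls how much the continuous pulse loses. The first exponential bounds a
  missed pulse, the second the false alarms in all slots of the own sender. A receiver without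
  direct gain has a single message and nothing to decide.\<close>

lemma pulse_position_code:
  fixes R P :: "real^'m::finite" and a :: "real^'m^'m" and \<rho> \<kappa> :: "'m \<Rightarrow> real" and K :: "'m \<Rightarrow> nat"
  assumes M: "prob_space M" and bm: "\<And>i. standard_brownian_motion M (B i)" and T: "T > 0"
    and R: "\<And>i. R $ i \<ge> 0" and P: "\<And>i. P $ i > 0"
    and \<rho>: "\<And>i. \<rho> i \<ge> 0" and \<kappa>: "\<And>i. \<kappa> i \<ge> 0"
    and a0: "\<And>i. a $ i $ i = 0 \<Longrightarrow> R $ i = 0"
    and a1: "\<And>i. a $ i $ i \<noteq> 0 \<Longrightarrow>
      sqrt (2 * \<rho> i) + \<kappa> i \<le> \<bar>a $ i $ i\<bar> * sqrt (P $ i) * (1 - 1 / (2 * real (K i) + 1))"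
  shows "\<exists>X g. is_code T R P X g \<and> error_probability M B a T R X g \<le>
    (\<Sum>i\<in>UNIV. exp (- ((\<kappa> i)\<^sup>2 / 2) * T) + exp (- (\<rho> i - R $ i) * T))"
proof -
  interpret prob_space M by fact
  \<comment> \<open>Each pair (i, k) of a sender and one of its messages owns a time slot [u i k, u i k + d].\<close>
  define S where "S = (SIGMA i:UNIV. messages T (R $ i))"
  have finS: "finite S" by (simp add: S_def)
  obtain h where h: "bij_betw h S {0..<card S}" using ex_bij_betw_finite_nat[OF finS] by auto
  define N where "N = card S"
  have "S \<noteq> {}" using one_in_messages[OF T R] by (auto simp: S_def)
  then have N: "N > 0" using finS by (simp add: N_def card_gt_0_iff)
  define d where "d = T / N"
  have d: "d > 0" using T N by (simp add: d_def)
  define u where "u i k = d * h (i, k)" for i k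
  have slot: "0 \<le> u i k" "u i k + d \<le> T" if "k \<in> messages T (R $ i)" for i k
  proof -
    show "0 \<le> u i k" using d by (simp add: u_def)
    have "h (i, k) < N" using that bij_betwE[OF h] by (auto simp: S_def N_def)
    then have "real (h (i, k)) + 1 \<le> N" by linarith
    then have "d * (real (h (i, k)) + 1) \<le> d * N" using d by (intro mult_left_mono) auto
    then show "u i k + d \<le> T" using N by (simp add: u_def d_def algebra_simps)
  qed
  \<comment> \<open>Covers the other messages of the same sender and all messages of the other
    senders alike. Neighbouring slots share an endpoint, where both pulses vanish.\<close>
  have disj: "u i k + d \<le> u j l \<or> u j l + d \<le> u i k"
    if "k \<in> messages T (R $ i)" "l \<in> messages T (R $ j)" "(i, k) \<noteq> (j, l)" for i k j l
  proof -
    have le: "d * real m + d \<le> d * real n" if "m < n" for m n :: nat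
    proof -
      have "real m + 1 \<le> real n" using that by linarith
      then have "d * (real m + 1) \<le> d * real n" using d by (intro mult_left_mono) auto
      then show ?thesis by (simp add: algebra_simps)
    qed
    have "h (i, k) \<noteq> h (j, l)"
      using that h by (auto simp: bij_betw_def inj_on_def S_def)
    then show ?thesis using le unfolding u_def by (meson linorder_neqE_nat)
  qed
  \<comment> \<open>Height for which a rectangular pulse of length \<open>d\<close> uses the full
    energy \<open>P $ i * T\<close>.\<close>
  define A where "A i = sqrt (P $ i * T / d)" for i
  define X where "X i k = (\<lambda>s\<in>{0..T}. A i * pulse (K i) (u i k) d s)" for i k
  \<comment> \<open>The noise increment over a slot has standard deviation \<open>sqrt d\<close>, so
    this is \<open>sqrt (2 * \<rho> i * T)\<close> standard deviations, with tail
    \<open>exp (- \<rho> i * T)\<close>.\<close>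
  define \<tau> where "\<tau> i = sqrt (2 * \<rho> i) * sqrt (T * d)" for i
  define g where "g i = threshold_decoder (messages T (R $ i)) (u i) d (sgn (a $ i $ i)) (\<tau> i)" for i
  have XC: "X i k \<in> C_interval T" for i k
  proof -
    have "continuous_on {0..T} (\<lambda>s. A i * pulse (K i) (u i k) d s)"
      by (intro continuous_intros continuous_on_pulse)
    then have "continuous_on {0..T} (X i k)" by (rule continuous_on_eq) (simp add: X_def)
    then show ?thesis by (simp add: C_interval_def X_def)
  qed
  have energy: "1 / T * integral {0..T} (\<lambda>s. (X i k s)\<^sup>2) \<le> P $ i" if "k \<in> messages T (R $ i)" for i k
  proof -
    have "integral {0..T} (\<lambda>s. (X i k s)\<^sup>2) = integral {0..T} (\<lambda>s. (A i * pulse (K i) (u i k) d s)\<^sup>2)"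
      by (rule integral_cong) (simp add: X_def)
    also have "\<dots> \<le> (A i)\<^sup>2 * d" by (rule energy_pulse[OF d slot[OF that]])
    also have "\<dots> = P $ i * T" using P[of i] T d by (simp add: A_def)
    finally show ?thesis using T by (simp add: field_simps)
  qed
  have code: "is_code T R P X g"
    unfolding is_code_def
  proof (intro conjI allI)
    fix i
    show "X i \<in> messages T (R $ i) \<rightarrow> C_interval T" using XC by auto
    show "AE w in message_law T R. 1 / T * integral {0..T} (\<lambda>s. (X i (w i) s)\<^sup>2) \<le> P $ i"
      by (rule AE_I2) (auto simp: message_law_def space_PiM space_uniform_count_measure PiE_iff
        simp del: times_divide_eq_left intro!: energy)
    show "g i \<in> C_measurable_space T \<rightarrow>\<^sub>M count_space (messages T (R $ i))"
      unfolding g_def using one_in_messages[OF T R] d slot by (intro threshold_decoder_measurable) auto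
  qed (use T R P in auto)
  have pulse_integral: "integral {u i k..u i k + d} (X j l) =
      (if (i, k) = (j, l) then A i * (d * (1 - 1 / (2 * real (K i) + 1))) else 0)"
    if "k \<in> messages T (R $ i)" "l \<in> messages T (R $ j)" for i k j l
  proof -
    have "integral {u i k..u i k + d} (X j l) =
        integral {u i k..u i k + d} (\<lambda>s. A j * pulse (K j) (u j l) d s)"
      by (rule integral_cong) (use slot[OF that(1)] in \<open>auto simp: X_def\<close>)
    also have "\<dots> = A j * integral {u i k..u i k + d} (pulse (K j) (u j l) d)" by simp
    also have "\<dots> = (if (i, k) = (j, l) then A i * (d * (1 - 1 / (2 * real (K i) + 1))) else 0)"
      using integral_pulse[OF d] integral_pulse_disjoint[OF d disj[OF that]] by auto
    finally show ?thesis .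
  qed
  define D where "D i k \<omega> = B i (u i k + d) \<omega> - B i (u i k) \<omega>" for i k \<omega>
  have incr: "output_path a B X T i (w, \<omega>) (u i k + d) - output_path a B X T i (w, \<omega>) (u i k) =
      (if w i = k then a $ i $ i * (A i * (d * (1 - 1 / (2 * real (K i) + 1)))) else 0) + D i k \<omega>"
    if w: "w \<in> message_tuples T R" and k: "k \<in> messages T (R $ i)" for w i k \<omega>
  proof -
    have wj: "w j \<in> messages T (R $ j)" for j using w by (auto simp: message_tuples_def)
    have "output_path a B X T i (w, \<omega>) (u i k + d) - output_path a B X T i (w, \<omega>) (u i k) =
        mean_output a X i w (u i k + d) - mean_output a X i w (u i k) + D i k \<omega>"
      using slot[OF k] d by (simp add: output_path_eq D_def)
    also have "mean_output a X i w (u i k + d) - mean_output a X i w (u i k) =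
        (\<Sum>j\<in>UNIV. a $ i $ j * integral {u i k..u i k + d} (X j (w j)))"
      using slot[OF k] d XC by (intro mean_output_increment) auto
    also have "\<dots> = (\<Sum>j\<in>UNIV. if j = i then (if w i = k then a $ i $ i * (A i * (d * (1 - 1 / (2 * real (K i) + 1)))) else 0) else 0)"
      by (rule sum.cong) (auto simp: pulse_integral[OF k wj])
    also have "\<dots> = (if w i = k then a $ i $ i * (A i * (d * (1 - 1 / (2 * real (K i) + 1)))) else 0)"
      by simp
    finally show ?thesis .
  qed
  have D: "distributed M lborel (D i k) (normal_density 0 (sqrt d))" if "k \<in> messages T (R $ i)" for i k
  proof -
    have "0 \<le> u i k \<and> u i k < u i k + d" using slot[OF that] d by simp
    then have "distributed M lborel (\<lambda>\<omega>. B i (u i k + d) \<omega> - B i (u i k) \<omega>)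
        (normal_density 0 (sqrt (u i k + d - u i k)))"
      using bm[of i] unfolding standard_brownian_motion_def by blast
    then show ?thesis by (simp add: D_def[abs_def])
  qed
  have D_meas: "D i k \<in> borel_measurable M" if "k \<in> messages T (R $ i)" for i k
    using distributed_measurable[OF D[OF that]] by simp
  let ?b = "\<lambda>i. exp (- ((\<kappa> i)\<^sup>2 / 2) * T) + exp (- (\<rho> i - R $ i) * T)"
  have tail: "prob {\<omega>\<in>space M. x * sqrt (T * d) \<le> c * D i k \<omega>} \<le> exp (- (x\<^sup>2 / 2) * T)"
    if "k \<in> messages T (R $ i)" "\<bar>c\<bar> = 1" "x \<ge> 0" for i k c x
  proof -
    have eq: "- (x * sqrt (T * d))\<^sup>2 / (2 * (sqrt d)\<^sup>2) = - (x\<^sup>2 / 2) * T"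
      using T d by (simp add: power_mult_distrib)
    show ?thesis
      unfolding eq[symmetric] by (rule normal_tail_bound[OF D[OF that(1)] _ that(2)]) (use T d that(3) in auto)
  qed
  have err: "prob {\<omega>\<in>space M. g i (output_path a B X T i (w, \<omega>)) \<noteq> w i} \<le> ?b i"
    if w: "w \<in> message_tuples T R" for w i
  proof -
    have wi: "w i \<in> messages T (R $ i)" using w by (auto simp: message_tuples_def)
    show ?thesis
    proof (cases "a $ i $ i = 0")
      case True
      \<comment> \<open>Zero gain forces rate 0, and \<open>exp 0\<close> is 1: with one message
        every decision is right.\<close>
      then have "messages T (R $ i) = {1}" using a0 by (simp add: messages_def)
      moreover have "g i y \<in> messages T (R $ i)" for y
        unfolding g_def by (rule threshold_decoder_in[OF one_in_messages[OF T R]])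
      ultimately have "g i y = w i" for y using wi by auto
      then show ?thesis by (simp add: add_nonneg_nonneg)
    next
      case False
      let ?c = "sgn (a $ i $ i)"
      have c: "\<bar>?c\<bar> = 1" "\<bar>- ?c\<bar> = 1" using False by (auto simp: sgn_if)
      \<comment> \<open>\<open>?E k\<close> is a false alarm caused by noise in an empty slot;
        \<open>?F\<close> is noise cancelling the whole margin of the true pulse, hence the opposite
        sign.\<close>
      let ?E = "\<lambda>k. {\<omega>\<in>space M. sqrt (2 * \<rho> i) * sqrt (T * d) \<le> ?c * D i k \<omega>}"
      let ?F = "{\<omega>\<in>space M. \<kappa> i * sqrt (T * d) \<le> - ?c * D i (w i) \<omega>}"
      have E: "?E k \<in> events" if "k \<in> messages T (R $ i)" for k
        using D_meas[OF that] by measurable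
      have F: "?F \<in> events" using D_meas[OF wi] by measurable
      have Ad: "A i * d = sqrt (P $ i) * sqrt (T * d)"
      proof -
        have "sqrt (P $ i * T / d) * d = sqrt (P $ i * T / d) * sqrt (d * d)" using d by simp
        also have "\<dots> = sqrt (P $ i * T / d * (d * d))" by (rule real_sqrt_mult[symmetric])
        also have "P $ i * T / d * (d * d) = P $ i * (T * d)" using d by simp
        finally show ?thesis by (simp add: A_def real_sqrt_mult)
      qed
      \<comment> \<open>The hypothesis \<open>a1\<close> multiplied by \<open>sqrt (T * d)\<close>,
        since the area \<open>A i * d\<close> equals
        \<open>sqrt (P $ i) * sqrt (T * d)\<close>.\<close>
      have signal: "\<tau> i + \<kappa> i * sqrt (T * d) \<le> ?c * (a $ i $ i * (A i * (d * (1 - 1 / (2 * real (K i) + 1)))))"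
      proof -
        have "\<tau> i + \<kappa> i * sqrt (T * d) = (sqrt (2 * \<rho> i) + \<kappa> i) * sqrt (T * d)"
          by (simp add: \<tau>_def distrib_right)
        also have "\<dots> \<le> \<bar>a $ i $ i\<bar> * sqrt (P $ i) * (1 - 1 / (2 * real (K i) + 1)) * sqrt (T * d)"
          using a1[OF False] T d by (intro mult_right_mono) auto
        also have "\<dots> = \<bar>a $ i $ i\<bar> * (A i * d * (1 - 1 / (2 * real (K i) + 1)))"
          unfolding Ad by (simp only: mult_ac)
        also have "\<dots> = ?c * a $ i $ i * (A i * d * (1 - 1 / (2 * real (K i) + 1)))"
          by (simp add: abs_sgn mult.commute)
        finally show ?thesis by (simp only: mult.assoc)
      qed
      have "{\<omega>\<in>space M. g i (output_path a B X T i (w, \<omega>)) \<noteq> w i} \<subseteq>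
          ?F \<union> (\<Union>k\<in>messages T (R $ i) - {w i}. ?E k)"
      proof
        fix \<omega> assume "\<omega> \<in> {\<omega>\<in>space M. g i (output_path a B X T i (w, \<omega>)) \<noteq> w i}"
        then have \<omega>: "\<omega> \<in> space M" and ne: "g i (output_path a B X T i (w, \<omega>)) \<noteq> w i" by auto
        from threshold_decoder_error[OF wi ne[unfolded g_def]]
        show "\<omega> \<in> ?F \<union> (\<Union>k\<in>messages T (R $ i) - {w i}. ?E k)"
        proof
          assume "?c * (output_path a B X T i (w, \<omega>) (u i (w i) + d) - output_path a B X T i (w, \<omega>) (u i (w i))) \<le> \<tau> i"
          then have "?c * (a $ i $ i * (A i * (d * (1 - 1 / (2 * real (K i) + 1))))) + ?c * D i (w i) \<omega> \<le> \<tau> i"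
            unfolding incr[OF w wi] by (simp only: distrib_left if_True simp_thms)
          with signal \<omega> show ?thesis by simp
        next
          assume "\<exists>l\<in>messages T (R $ i) - {w i}. \<tau> i < ?c * (output_path a B X T i (w, \<omega>) (u i l + d) - output_path a B X T i (w, \<omega>) (u i l))"
          then obtain l where l: "l \<in> messages T (R $ i)" "l \<noteq> w i"
            "\<tau> i < ?c * (output_path a B X T i (w, \<omega>) (u i l + d) - output_path a B X T i (w, \<omega>) (u i l))" by auto
          then have "\<tau> i \<le> ?c * D i l \<omega>" using incr[OF w l(1), of \<omega>] by auto
          then show ?thesis using l \<omega> by (auto simp: \<tau>_def)
        qed
      qed
      note sub = this
      have EU: "(\<Union>k\<in>messages T (R $ i) - {w i}. ?E k) \<in> events"
      proof (rule sets.finite_UN)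
        show "?E k \<in> events" if "k \<in> messages T (R $ i) - {w i}" for k using that by (intro E) blast
      qed simp
      have "prob {\<omega>\<in>space M. g i (output_path a B X T i (w, \<omega>)) \<noteq> w i} \<le>
          prob (?F \<union> (\<Union>k\<in>messages T (R $ i) - {w i}. ?E k))"
        by (rule finite_measure_mono[OF sub sets.Un[OF F EU]])
      also have "\<dots> \<le> prob ?F + prob (\<Union>k\<in>messages T (R $ i) - {w i}. ?E k)"
        by (rule measure_Un_le[OF F EU])
      also have "prob (\<Union>k\<in>messages T (R $ i) - {w i}. ?E k) \<le> (\<Sum>k\<in>messages T (R $ i) - {w i}. prob (?E k))"
      proof (rule finite_measure_subadditive_finite)
        show "?E ` (messages T (R $ i) - {w i}) \<subseteq> events" using E by blast
      qed simp
      also have "\<dots> \<le> (\<Sum>k\<in>messages T (R $ i) - {w i}. exp (- \<rho> i * T))"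
      proof (rule sum_mono)
        fix k assume "k \<in> messages T (R $ i) - {w i}"
        then show "prob (?E k) \<le> exp (- \<rho> i * T)"
          using tail[OF _ c(1), of k i "sqrt (2 * \<rho> i)"] \<rho>[of i] by simp
      qed
      also have "\<dots> \<le> card (messages T (R $ i)) * exp (- \<rho> i * T)"
        using card_mono[of "messages T (R $ i)" "messages T (R $ i) - {w i}"] by (simp add: mult_right_mono)
      also have "\<dots> \<le> exp (T * R $ i) * exp (- \<rho> i * T)"
        by (intro mult_right_mono card_messages_le) simp
      also have "\<dots> = exp (- (\<rho> i - R $ i) * T)"
        by (simp add: exp_add[symmetric] algebra_simps)
      also have "prob ?F \<le> exp (- ((\<kappa> i)\<^sup>2 / 2) * T)"
        by (rule tail[OF wi c(2) \<kappa>])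
      finally show ?thesis by simp
    qed
  qed
  \<comment> \<open>Here the noises of different receivers meet; the union bound makes their
    dependence irrelevant.\<close>
  have err_w: "prob {\<omega>\<in>space M. \<exists>i. g i (output_path a B X T i (w, \<omega>)) \<noteq> w i} \<le> (\<Sum>i\<in>UNIV. ?b i)"
    if w: "w \<in> message_tuples T R" for w
  proof -
    have ev: "{\<omega>\<in>space M. g i (output_path a B X T i (w, \<omega>)) \<noteq> w i} \<in> events" for i
    proof -
      have "{\<omega>\<in>space M. g i (output_path a B X T i (w, \<omega>)) \<noteq> w i} =
          space M - {\<omega>\<in>space M. g i (\<lambda>t\<in>{0..T}. mean_output a X i w t + B i t \<omega>) = w i}"
        by (auto simp: output_path_eq)
      then show ?thesis using decoder_event[OF bm continuous_on_mean_output[OF code w] code] by auto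
    qed
    have "prob {\<omega>\<in>space M. \<exists>i. g i (output_path a B X T i (w, \<omega>)) \<noteq> w i} =
        prob (\<Union>i\<in>UNIV. {\<omega>\<in>space M. g i (output_path a B X T i (w, \<omega>)) \<noteq> w i})"
      by (rule arg_cong[where f = prob]) auto
    also have "\<dots> \<le> (\<Sum>i\<in>UNIV. prob {\<omega>\<in>space M. g i (output_path a B X T i (w, \<omega>)) \<noteq> w i})"
      using ev by (intro finite_measure_subadditive_finite) auto
    also have "\<dots> \<le> (\<Sum>i\<in>UNIV. ?b i)" by (rule sum_mono) (rule err[OF w])
    finally show ?thesis .
  qed
  have "error_probability M B a T R X g \<le> (\<Sum>i\<in>UNIV. ?b i)"
  proof -
    have cardW: "real (card (message_tuples T R)) > 0"
      using card_messages_pos[OF T R] by (simp add: message_tuples_def card_PiE prod_pos)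
    have "(\<Sum>w\<in>message_tuples T R. prob {\<omega>\<in>space M. \<exists>i. g i (output_path a B X T i (w, \<omega>)) \<noteq> w i})
        \<le> (\<Sum>w\<in>message_tuples T R. \<Sum>i\<in>UNIV. ?b i)"
      by (rule sum_mono) (rule err_w)
    then show ?thesis
      using cardW by (simp add: error_probability_eq[OF M bm code] pos_divide_le_eq mult.commute)
  qed
  with code show ?thesis by blast
qed

lemma achievable_below_capacity:
  fixes R P :: "real^'m::finite"
  assumes M: "prob_space M" and bm: "\<And>i. standard_brownian_motion M (B i)"
    and P: "\<And>i. P $ i > 0" and R: "\<And>i. R $ i \<ge> 0"
    and a0: "\<And>i. a $ i $ i = 0 \<Longrightarrow> R $ i = 0"
    and a1: "\<And>i. a $ i $ i \<noteq> 0 \<Longrightarrow> R $ i < (a $ i $ i)\<^sup>2 * P $ i / 2"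
  shows "achievable M B a P R"
proof -
  have "\<exists>\<rho> \<kappa> K. \<rho> > R $ i \<and> \<kappa> > 0 \<and> (a $ i $ i \<noteq> 0 \<longrightarrow>
      sqrt (2 * \<rho>) + \<kappa> \<le> \<bar>a $ i $ i\<bar> * sqrt (P $ i) * (1 - 1 / (2 * real (K::nat) + 1)))" for i
  proof (cases "a $ i $ i = 0")
    case True
    then show ?thesis by (intro exI[of _ "R $ i + 1"] exI[of _ 1]) auto
  next
    case False
    define c where "c = \<bar>a $ i $ i\<bar> * sqrt (P $ i)"
    have c: "c > 0" using False P[of i] by (simp add: c_def)
    have c2: "c\<^sup>2 = (a $ i $ i)\<^sup>2 * P $ i" using P[of i] by (simp add: c_def power_mult_distrib)
    define q where "q = (a $ i $ i)\<^sup>2 * P $ i"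
    have q: "R $ i < q / 2" using a1[OF False] by (simp add: q_def)
    \<comment> \<open>The midpoint between the rate and \<open>c\<^sup>2 / 2\<close>, so
      \<open>sqrt (2 * \<rho>) < c\<close> leaves room for both the pulse loss and a margin.\<close>
    define \<rho> where "\<rho> = (R $ i + c\<^sup>2 / 2) / 2"
    have \<rho>1: "R $ i < \<rho>" using q unfolding \<rho>_def c2 q_def[symmetric] by (simp add: field_simps)
    have \<rho>2: "2 * \<rho> < c\<^sup>2" using q unfolding \<rho>_def c2 q_def[symmetric] by (simp add: field_simps)
    have "sqrt (2 * \<rho>) < sqrt (c\<^sup>2)" using \<rho>2 by (rule real_sqrt_less_mono)
    then have s: "sqrt (2 * \<rho>) < c" using c by simp
    then have "0 < 1 - sqrt (2 * \<rho>) / c" using c by simp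
    \<comment> \<open>A pulse flat enough that its relative loss stays below the relative gap
      between \<open>c\<close> and the threshold; the rest of the gap becomes \<kappa>.\<close>
    from reals_Archimedean[OF this] obtain n where n: "inverse (real (Suc n)) < 1 - sqrt (2 * \<rho>) / c" by auto
    have "1 / (2 * real (Suc n) + 1) \<le> inverse (real (Suc n))" by (simp add: field_simps)
    with n have "sqrt (2 * \<rho>) / c < 1 - 1 / (2 * real (Suc n) + 1)" by linarith
    then have "sqrt (2 * \<rho>) < c * (1 - 1 / (2 * real (Suc n) + 1))"
      using c by (simp only: pos_divide_less_eq mult.commute)
    then show ?thesis using \<rho>1
      by (intro exI[of _ \<rho>] exI[of _ "c * (1 - 1 / (2 * real (Suc n) + 1)) - sqrt (2 * \<rho>)"] exI[of _ "Suc n"])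
        (simp add: c_def)
  qed
  then obtain \<rho> \<kappa> K where \<rho>: "\<And>i. \<rho> i > R $ i" and \<kappa>: "\<And>i. \<kappa> i > (0::real)"
    and K: "\<And>i. a $ i $ i \<noteq> 0 \<Longrightarrow> sqrt (2 * \<rho> i) + \<kappa> i \<le>
      \<bar>a $ i $ i\<bar> * sqrt (P $ i) * (1 - 1 / (2 * real (K i :: nat) + 1))"
    by metis
  define T where "T n = real n + 1" for n :: nat
  let ?b = "\<lambda>t. \<Sum>i\<in>UNIV. exp (- ((\<kappa> i)\<^sup>2 / 2) * t) + exp (- (\<rho> i - R $ i) * t)"
  define good where "good n X g \<longleftrightarrow> is_code (T n) R P X g \<and> error_probability M B a (T n) R X g \<le> ?b (T n)"
    for n X g
  have "\<exists>X g. good n X g" for n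
    unfolding good_def
  proof (rule pulse_position_code[OF M bm _ R P _ _ a0 K])
    show "0 \<le> \<rho> i" "0 \<le> \<kappa> i" for i using R[of i] \<rho>[of i] \<kappa>[of i] by linarith+
  qed (simp_all add: T_def)
  then obtain X g where good: "\<And>n. good n (X n) (g n)" by metis
  have code: "is_code (T n) R P (X n) (g n)"
    and err: "error_probability M B a (T n) R (X n) (g n) \<le> ?b (T n)" for n
    using good[of n] unfolding good_def by blast+
  have T: "filterlim T at_top sequentially"
    unfolding T_def by (rule filterlim_at_top_mono[OF filterlim_real_sequentially]) simp
  have "(\<lambda>n. ?b (T n)) \<longlonglongrightarrow> (\<Sum>i\<in>(UNIV::'m set). 0 + 0)"
    using \<rho> \<kappa> by (intro tendsto_sum tendsto_add exp_neg_tendsto_0[OF T]) (auto simp: zero_less_power2 less_imp_neq[symmetric])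
  then have lim: "(\<lambda>n. ?b (T n)) \<longlonglongrightarrow> 0" by simp
  have "error_probability M B a (T n) R (X n) (g n) \<ge> 0" for n
    unfolding error_probability_eq[OF M bm code] by (intro divide_nonneg_nonneg sum_nonneg) auto
  then have "(\<lambda>n. error_probability M B a (T n) R (X n) (g n)) \<longlonglongrightarrow> 0"
    using err by (intro tendsto_sandwich[OF _ _ tendsto_const lim] always_eventually allI) auto
  with T code show ?thesis unfolding achievable_def by blast
qed

theorem theorem5p4:
  fixes M :: "'a measure"
    and B :: "'m::finite \<Rightarrow> real \<Rightarrow> 'a \<Rightarrow> real"
    and a :: "real^'m^'m"
    and P :: "real^'m"
  assumes "prob_space M"
    and "\<And>i. standard_brownian_motion M (B i)"
    and "\<And>i. P $ i > 0"
  shows "capacity_region M B a P =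
           {R. \<forall>i. 0 \<le> R $ i \<and> R $ i \<le> (a $ i $ i)\<^sup>2 * P $ i / 2}"
proof
  let ?C = "{R. \<forall>i. 0 \<le> R $ i \<and> R $ i \<le> (a $ i $ i)\<^sup>2 * P $ i / 2}"
  have "closed ?C"
    by (intro closed_Collect_all closed_Collect_conj closed_Collect_le continuous_intros)
  moreover have "{R. achievable M B a P R} \<subseteq> ?C"
    using achievable_rate_le[where B = B, OF assms(1,2)] by blast
  ultimately show "capacity_region M B a P \<subseteq> ?C"
    unfolding capacity_region_def by (rule closure_minimal[rotated])
  show "?C \<subseteq> capacity_region M B a P"
  proof
    fix R assume R: "R \<in> ?C"
    \<comment> \<open>Shrinking towards 0 puts every positive coordinate strictly below its bound
      and keeps the zero coordinates, in particular those forced by a vanishing gain, at 0.\<close>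
    let ?S = "\<lambda>n. (1 - inverse (real (Suc n))) *\<^sub>R R"
    have "achievable M B a P (?S n)" for n
    proof (rule achievable_below_capacity[where B = B, OF assms])
      fix i
      have pos: "0 \<le> 1 - inverse (real (Suc n))" by (simp add: field_simps)
      show "0 \<le> ?S n $ i" using R pos by simp
      show "?S n $ i = 0" if "a $ i $ i = 0"
      proof -
        have "0 \<le> R $ i" "R $ i \<le> (a $ i $ i)\<^sup>2 * P $ i / 2" using R by auto
        then show ?thesis using that by simp
      qed
      show "?S n $ i < (a $ i $ i)\<^sup>2 * P $ i / 2" if "a $ i $ i \<noteq> 0"
      proof (cases "R $ i = 0")
        case False
        then have "R $ i > 0" using R by (auto simp: less_le)
        then have "?S n $ i < R $ i" by simp
        also have "\<dots> \<le> (a $ i $ i)\<^sup>2 * P $ i / 2" using R by auto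
        finally show ?thesis .
      qed (use that assms(3)[of i] in simp)
    qed
    moreover have "?S \<longlonglongrightarrow> (1 - 0) *\<^sub>R R"
      by (intro tendsto_intros LIMSEQ_inverse_real_of_nat)
    ultimately show "R \<in> capacity_region M B a P"
      unfolding capacity_region_def closure_sequential by (intro exI[of _ ?S]) simp
  qed
qed

end
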